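(* Let $m=m(n)>n$, $N=N(n)$, $d=d(n)$ with $N,d\le\mathrm{poly}(m)$. Assume there exists a demi-bits generator $\{G_n:\{0,1\}^n\to\{0,1\}^N\}$ and that $\mathsf{Ext}:\{0,1\}^N\times\{0,1\}^d\to\{0,1\}^m$ is an $(N-1,2^{-m-1})$-strong seeded extractor. Then the range avoidance problem restricted to polynomial-size circuits with $n$ inputs and $m$ outputs is not in $\mathbf{SearchNP}$.
   Context: Range avoidance: given a circuit $C:\{0,1\}^n\to\{0,1\}^m$ with $m>n$, output $y\notin\mathrm{Range}(C)$. $\mathbf{SearchNP}$: search problems solvable by a nondeterministic polynomial-time machine $M$ such that on every input having a solution, $M$ has an accepting path and every accepting path outputs a valid solution, and on inputs without solutions $M$ has no accepting path. A random variable $X$ is a $k$-source if $\Pr[X=x]\le 2^{-k}$ for all $x$. A polynomial-time computable $\mathsf{Ext}:\{0,1\}^N\times\{0,1\}^d\to\{0,1\}^m$ is a $(k,\varepsilon)$-strong seeded extractor if for every $k$-source $X$ on $\{0,1\}^N$, the statistical distance between $(U_d,\mathsf{Ext}(X,U_d))$ and $(U_d,U_m)$ is at most $\varepsilon$. A family $\{G_n:\{0,1\}^n\to\{0,1\}^{N(n)}\}$ with $N(n)>n$, computable by polynomial-size circuits, is a demi-bits generator (secure against $\mathbf{NP}/\mathrm{poly}$) if for every family $\{D\}$ of polynomial-size nondeterministic circuits and all sufficiently large $n$, it is not the case that both $\Pr_{y\sim\{0,1\}^{N}}[D(y)=1]\ge 1/3$ and $D(G_n(x))=0$ for all $x$.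 *)

theory Defs
  imports "HOL-Probability.Probability"
begin

datatype gate = GIn nat | GConst bool | GNot nat | GAnd nat nat | GOr nat nat

record circuit =
  ninp :: nat
  gates :: "gate list"   \<comment> \<open>gate i may refer to wires 0..i-1 (reference to a later wire reads False)\<close>
  outs :: "nat list"

definition lk :: "bool list \<Rightarrow> nat \<Rightarrow> bool" where
  "lk vs i = (if i < length vs then vs ! i else False)"

fun gate_val :: "bool list \<Rightarrow> bool list \<Rightarrow> gate \<Rightarrow> bool" where
  "gate_val x vs (GIn i) = lk x i"
| "gate_val x vs (GConst b) = b"
| "gate_val x vs (GNot i) = (\<not> lk vs i)"
| "gate_val x vs (GAnd i j) = (lk vs i \<and> lk vs j)"
| "gate_val x vs (GOr i j) = (lk vs i \<or> lk vs j)"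

definition wires :: "bool list \<Rightarrow> gate list \<Rightarrow> bool list" where
  "wires x gs = foldl (\<lambda>vs g. vs @ [gate_val x vs g]) [] gs"

definition circ_eval :: "circuit \<Rightarrow> bool list \<Rightarrow> bool list" where
  "circ_eval C x = map (lk (wires x (gates C))) (outs C)"

definition circ_size :: "circuit \<Rightarrow> nat" where
  "circ_size C = ninp C + length (gates C) + length (outs C)"

definition poly_bounded :: "(nat \<Rightarrow> nat) \<Rightarrow> (nat \<Rightarrow> nat) \<Rightarrow> bool" where
  "poly_bounded f g \<longleftrightarrow> (\<exists>c::nat. \<forall>n. f n \<le> c * (g n) ^ c + c)"

text \<open>A nondeterministic circuit D with k regular inputs: its remaining
  ninp D - k inputs are witness bits; D(y)=1 iff some witness makes the (single) output true.\<close>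
definition ndet_accepts :: "circuit \<Rightarrow> nat \<Rightarrow> bool list \<Rightarrow> bool" where
  "ndet_accepts D k y \<longleftrightarrow> (\<exists>z. length z = ninp D - k \<and> circ_eval D (y @ z) = [True])"

definition frac_accepted :: "circuit \<Rightarrow> nat \<Rightarrow> real" where
  "frac_accepted D k = real (card {y. length y = k \<and> ndet_accepts D k y}) / 2 ^ k"

definition demibits_generator :: "(nat \<Rightarrow> nat) \<Rightarrow> (nat \<Rightarrow> bool list \<Rightarrow> bool list) \<Rightarrow> bool" where
  "demibits_generator N G \<longleftrightarrow>
     (\<forall>n. N n > n) \<and>
     (\<forall>n x. length x = n \<longrightarrow> length (G n x) = N n) \<and>
     (\<exists>CG. poly_bounded (\<lambda>n. circ_size (CG n)) (\<lambda>n. n) \<and>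
           (\<forall>n. ninp (CG n) = n \<and> (\<forall>x. length x = n \<longrightarrow> circ_eval (CG n) x = G n x))) \<and>
     (\<forall>D. poly_bounded (\<lambda>n. circ_size (D n)) (\<lambda>n. n) \<and>
          (\<forall>n. N n \<le> ninp (D n) \<and> length (outs (D n)) = 1) \<longrightarrow>
          (\<exists>n0. \<forall>n\<ge>n0. \<not> (frac_accepted (D n) (N n) \<ge> 1/3 \<and>
                              (\<forall>x. length x = n \<longrightarrow> \<not> ndet_accepts (D n) (N n) (G n x)))))"

text \<open>Tape symbols: 0 = blank, 1 = bit False, 2 = bit True, further symbols allowed.
  A transition (q, a, q', b, mv) reads a in state q, writes b, moves by mv \<in> {-1,0,1}
  and enters q'. The accept state has no outgoing transitions.\<close>
record ntm =
  start :: nat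
  accept :: nat
  trans :: "(nat \<times> nat \<times> nat \<times> nat \<times> int) set"

type_synonym config = "nat \<times> int \<times> (int \<Rightarrow> nat)"

definition ntm_wf :: "ntm \<Rightarrow> bool" where
  "ntm_wf M \<longleftrightarrow> finite (trans M) \<and>
     (\<forall>(q, a, q', b, mv) \<in> trans M. mv \<in> {-1, 0, 1} \<and> q \<noteq> accept M)"

definition deterministic :: "ntm \<Rightarrow> bool" where
  "deterministic M \<longleftrightarrow> (\<forall>q a r1 r2. (q, a, r1) \<in> trans M \<longrightarrow> (q, a, r2) \<in> trans M \<longrightarrow> r1 = r2)"

definition bit_sym :: "bool \<Rightarrow> nat" where
  "bit_sym b = (if b then 2 else 1)"

definition init_config :: "ntm \<Rightarrow> bool list \<Rightarrow> config" where
  "init_config M w = (start M, 0,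
     (\<lambda>i. if 0 \<le> i \<and> nat i < length w then bit_sym (w ! nat i) else 0))"

definition step :: "ntm \<Rightarrow> config \<Rightarrow> config \<Rightarrow> bool" where
  "step M c c' \<longleftrightarrow> (case c of (q, h, t) \<Rightarrow>
     (\<exists>q' b mv. (q, t h, q', b, mv) \<in> trans M \<and> c' = (q', h + mv, t(h := b))))"

definition tape_output :: "(int \<Rightarrow> nat) \<Rightarrow> bool list" where
  "tape_output t = (let L = (LEAST j::nat. t (int j) \<notin> {1, 2}) in map (\<lambda>j. t (int j) = 2) [0..<L])"

definition accepts_with :: "ntm \<Rightarrow> bool list \<Rightarrow> bool list \<Rightarrow> bool" where
  "accepts_with M w y \<longleftrightarrow> (\<exists>q h t. (step M)\<^sup>*\<^sup>* (init_config M w) (q, h, t) \<and>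
                                     q = accept M \<and> tape_output t = y)"

definition poly_time :: "ntm \<Rightarrow> bool" where
  "poly_time M \<longleftrightarrow> (\<exists>c::nat. \<forall>w k c'. (step M ^^ k) (init_config M w) c' \<longrightarrow>
                                   k \<le> c * (length w) ^ c + c)"

text \<open>SearchNP for a search problem with instance set I (a promise: inputs outside I are
  unconstrained) and solution relation R.\<close>
definition SearchNP :: "bool list set \<Rightarrow> (bool list \<Rightarrow> bool list \<Rightarrow> bool) \<Rightarrow> bool" where
  "SearchNP I R \<longleftrightarrow> (\<exists>M. ntm_wf M \<and> poly_time M \<and>
     (\<forall>w\<in>I. ((\<exists>y. R w y) \<longrightarrow> (\<exists>y. accepts_with M w y) \<and> (\<forall>y. accepts_with M w y \<longrightarrow> R w y)) \<and>
             ((\<not> (\<exists>y. R w y)) \<longrightarrow> \<not> (\<exists>y. accepts_with M w y))))"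

fun bin :: "nat \<Rightarrow> bool list" where
  "bin n = (if n = 0 then [] else odd n # bin (n div 2))"

definition sd :: "bool list \<Rightarrow> bool list" where  \<comment> \<open>self-delimiting encoding\<close>
  "sd xs = concat (map (\<lambda>b. [b, b]) xs) @ [False, True]"

definition enc_nat :: "nat \<Rightarrow> bool list" where
  "enc_nat k = sd (bin k)"

fun enc_gate :: "gate \<Rightarrow> bool list" where
  "enc_gate (GIn i) = enc_nat 0 @ enc_nat i"
| "enc_gate (GConst b) = enc_nat 1 @ enc_nat (if b then 1 else 0)"
| "enc_gate (GNot i) = enc_nat 2 @ enc_nat i"
| "enc_gate (GAnd i j) = enc_nat 3 @ enc_nat i @ enc_nat j"
| "enc_gate (GOr i j) = enc_nat 4 @ enc_nat i @ enc_nat j"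

definition enc_circ :: "circuit \<Rightarrow> bool list" where
  "enc_circ C = enc_nat (ninp C) @ enc_nat (length (gates C)) @ concat (map enc_gate (gates C))
                @ enc_nat (length (outs C)) @ concat (map enc_nat (outs C))"

definition stat_dist :: "'a pmf \<Rightarrow> 'a pmf \<Rightarrow> real" where
  "stat_dist P Q = (SUP E. \<bar>measure_pmf.prob P E - measure_pmf.prob Q E\<bar>)"

definition uniform_bits :: "nat \<Rightarrow> bool list pmf" where
  "uniform_bits k = pmf_of_set {x. length x = k}"

definition is_k_source :: "real \<Rightarrow> nat \<Rightarrow> bool list pmf \<Rightarrow> bool" where
  "is_k_source k len X \<longleftrightarrow> set_pmf X \<subseteq> {x. length x = len} \<and> (\<forall>x. pmf X x \<le> 2 powr (- k))"

definition strong_extractor ::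
  "(nat \<Rightarrow> nat) \<Rightarrow> (nat \<Rightarrow> nat) \<Rightarrow> (nat \<Rightarrow> nat) \<Rightarrow> (nat \<Rightarrow> bool list \<Rightarrow> bool list \<Rightarrow> bool list)
   \<Rightarrow> (nat \<Rightarrow> real) \<Rightarrow> (nat \<Rightarrow> real) \<Rightarrow> bool" where
  "strong_extractor N d m Ext k eps \<longleftrightarrow>
     (\<forall>n X s. length X = N n \<and> length s = d n \<longrightarrow> length (Ext n X s) = m n) \<and>
     (\<exists>M. ntm_wf M \<and> deterministic M \<and> poly_time M \<and>
        (\<forall>n X s y. length X = N n \<and> length s = d n \<longrightarrow>
           (accepts_with M (sd (replicate n True) @ sd X @ s) y \<longleftrightarrow> y = Ext n X s))) \<and>
     (\<forall>n X. is_k_source (k n) (N n) X \<longrightarrow>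
        stat_dist (map_pmf (\<lambda>(x, s). (s, Ext n x s)) (pair_pmf X (uniform_bits (d n))))
                  (pair_pmf (uniform_bits (d n)) (uniform_bits (m n))) \<le> eps n)"

definition avoid_instances :: "(nat \<Rightarrow> nat) \<Rightarrow> nat \<Rightarrow> bool list set" where
  "avoid_instances m c = {enc_circ C | C n. ninp C = n \<and> length (outs C) = m n \<and>
                                            circ_size C \<le> c * (m n) ^ c + c}"

definition avoid_rel :: "bool list \<Rightarrow> bool list \<Rightarrow> bool" where
  "avoid_rel w y \<longleftrightarrow> (\<exists>C. w = enc_circ C \<and> length y = length (outs C) \<and>
                         y \<notin> circ_eval C ` {x. length x = ninp C})"

end

theory Submission
  imports Defs
begin

text \<open>
  A solver \<open>M\<close> for range avoidance in SearchNP yields a nondeterministic distinguisher for the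
  generator \<open>G\<close>. Let \<open>C\<^sub>s\<close> be the circuit \<open>x \<mapsto> Ext (G x) s\<close> and let \<open>D\<close> accept \<open>z\<close> iff for some seed
  \<open>s\<close> some accepting path of \<open>M\<close> on \<open>C\<^sub>s\<close> outputs \<open>Ext z s\<close>. Every output of \<open>M\<close> on \<open>C\<^sub>s\<close> avoids the
  range of \<open>C\<^sub>s\<close>, so \<open>D\<close> rejects all of the range of \<open>G\<close>. If \<open>D\<close> rejected at least half of all \<open>z\<close>, the
  uniform distribution on the rejected strings would be an \<open>(N - 1)\<close>-source for which \<open>(s, Ext z s)\<close>
  never hits \<open>(s, y\<^sub>s)\<close>, where \<open>y\<^sub>s\<close> is one output of \<open>M\<close> on \<open>C\<^sub>s\<close>; as this event has probability
  \<open>2\<^sup>-\<^sup>m\<close> under the uniform distribution, the extractor error would exceed \<open>2\<^sup>-\<^sup>m\<^sup>-\<^sup>1\<close>.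

  For \<open>D\<close> to be a polynomial-size circuit, machine computations are unrolled into circuits. The seed
  enters \<open>C\<^sub>s\<close> only through gates whose encodings have the same length for both bit values, so
  every bit of the encoding of \<open>C\<^sub>s\<close> is a constant or a bit of \<open>s\<close>.
\<close>

section \<open>Simultaneous circuit complexity\<close>

lemma wires_Nil [simp]: "wires x [] = []"
  by (simp add: wires_def)

lemma wires_snoc [simp]: "wires x (gs @ [g]) = wires x gs @ [gate_val x (wires x gs) g]"
  by (simp add: wires_def)

lemma length_wires [simp]: "length (wires x gs) = length gs"
  by (induction gs rule: rev_induct) auto

lemma lk_append: "lk (xs @ ys) i = (if i < length xs then xs ! i else lk ys (i - length xs))"
  by (auto simp: lk_def nth_append)

lemma lk_nth [simp]: "i < length xs \<Longrightarrow> lk xs i = xs ! i"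
  by (simp add: lk_def)

type_synonym bfun = "bool list \<Rightarrow> bool"

fun gate_idx :: "gate \<Rightarrow> nat" where
  "gate_idx (GIn i) = i"
| "gate_idx (GConst b) = 0"
| "gate_idx (GNot i) = i"
| "gate_idx (GAnd i j) = max i j"
| "gate_idx (GOr i j) = max i j"

text \<open>All functions in \<open>A\<close> are wires of one common gate list, so shared
  subcomputations are paid for once. The index bound later limits the length of encodings, since
  \<open>circ_size\<close> says nothing about how large indices are; \<open>n + length gs\<close>
  leaves room for both input and wire indices.\<close>

definition ckt :: "nat \<Rightarrow> bfun set \<Rightarrow> nat \<Rightarrow> bool" where
  "ckt n A s \<longleftrightarrow> (\<exists>gs. length gs \<le> s \<and> (\<forall>g\<in>set gs. gate_idx g < n + length gs) \<and>
     (\<forall>f\<in>A. \<exists>i<length gs. \<forall>x. wires x gs ! i = f x))"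

lemma ckt_empty: "ckt n {} 0"
  by (simp add: ckt_def)

lemma ckt_mono: "ckt n A s \<Longrightarrow> B \<subseteq> A \<Longrightarrow> s \<le> s' \<Longrightarrow> ckt n B s'"
proof -
  assume "ckt n A s" "B \<subseteq> A" "s \<le> s'"
  then obtain gs where "length gs \<le> s" "\<forall>g\<in>set gs. gate_idx g < n + length gs"
    "\<forall>f\<in>A. \<exists>i<length gs. \<forall>x. wires x gs ! i = f x"
    unfolding ckt_def by blast
  with \<open>B \<subseteq> A\<close> \<open>s \<le> s'\<close> show ?thesis
    unfolding ckt_def by (intro exI[of _ gs]) auto
qed

text \<open>A gate only sees the wires before it, so appending one leaves all existing wire values
  intact.\<close>

lemma ckt_add_gate:
  assumes "length gs \<le> s" "\<forall>g\<in>set gs. gate_idx g < n + length gs"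
    and "\<forall>f\<in>A. \<exists>i<length gs. \<forall>x. wires x gs ! i = f x"
    and "gate_idx g < n + Suc (length gs)" "\<And>x. gate_val x (wires x gs) g = f x"
  shows "ckt n (insert f A) (Suc s)"
  unfolding ckt_def
proof (intro exI[of _ "gs @ [g]"] conjI ballI)
  fix h assume "h \<in> insert f A"
  then consider "h = f" | "h \<in> A" by blast
  then show "\<exists>i<length (gs @ [g]). \<forall>x. wires x (gs @ [g]) ! i = h x"
  proof cases
    case 1
    then show ?thesis using assms(5) by (intro exI[of _ "length gs"]) (simp add: nth_append)
  next
    case 2
    then obtain i where "i < length gs" "\<forall>x. wires x gs ! i = h x" using assms(3) by blast
    then show ?thesis by (intro exI[of _ i]) (simp add: nth_append)
  qed
qed (use assms in \<open>auto simp: less_Suc_eq\<close>)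

lemma ckt_input:
  assumes "ckt n A s" "i < n"
  shows "ckt n (insert (\<lambda>x. lk x i) A) (Suc s)"
proof -
  obtain gs where "length gs \<le> s" "\<forall>g\<in>set gs. gate_idx g < n + length gs"
    "\<forall>f\<in>A. \<exists>i<length gs. \<forall>x. wires x gs ! i = f x"
    using assms(1) unfolding ckt_def by blast
  from ckt_add_gate[OF this, of "GIn i"] assms(2) show ?thesis by simp
qed

lemma ckt_const:
  assumes "ckt n A s"
  shows "ckt n (insert (\<lambda>x. b) A) (Suc s)"
proof -
  obtain gs where "length gs \<le> s" "\<forall>g\<in>set gs. gate_idx g < n + length gs"
    "\<forall>f\<in>A. \<exists>i<length gs. \<forall>x. wires x gs ! i = f x"
    using assms(1) unfolding ckt_def by blast
  from ckt_add_gate[OF this, of "GConst b"] show ?thesis by simp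
qed

lemma ckt_not:
  assumes "ckt n A s" "f \<in> A"
  shows "ckt n (insert (\<lambda>x. \<not> f x) A) (Suc s)"
proof -
  obtain gs where gs: "length gs \<le> s" "\<forall>g\<in>set gs. gate_idx g < n + length gs"
    "\<forall>f\<in>A. \<exists>i<length gs. \<forall>x. wires x gs ! i = f x"
    using assms(1) unfolding ckt_def by blast
  then obtain i where "i < length gs" "\<forall>x. wires x gs ! i = f x" using assms(2) by blast
  with ckt_add_gate[OF gs, of "GNot i"] show ?thesis by simp
qed

lemma ckt_and_or:
  assumes "ckt n A s" "f \<in> A" "g \<in> A"
  shows "ckt n (insert (\<lambda>x. f x \<and> g x) A) (Suc s)" "ckt n (insert (\<lambda>x. f x \<or> g x) A) (Suc s)"
proof -
  obtain gs where gs: "length gs \<le> s" "\<forall>g\<in>set gs. gate_idx g < n + length gs"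
    "\<forall>f\<in>A. \<exists>i<length gs. \<forall>x. wires x gs ! i = f x"
    using assms(1) unfolding ckt_def by blast
  then obtain i where i: "i < length gs" "\<forall>x. wires x gs ! i = f x" using assms(2) by blast
  obtain j where "j < length gs" "\<forall>x. wires x gs ! j = g x" using gs(3) assms(3) by blast
  with i ckt_add_gate[OF gs, of "GAnd i j"] ckt_add_gate[OF gs, of "GOr i j"]
  show "ckt n (insert (\<lambda>x. f x \<and> g x) A) (Suc s)" "ckt n (insert (\<lambda>x. f x \<or> g x) A) (Suc s)"
    by simp_all
qed

text \<open>The number bounds the gates needed to add the function to a circuit that already provides
  the functions in the parameter set.\<close>
inductive der :: "bfun set \<Rightarrow> nat \<Rightarrow> bfun \<Rightarrow> bool" for A where
  der_base: "f \<in> A \<Longrightarrow> der A 0 f"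
| der_const: "der A 1 (\<lambda>x. b)"
| der_not: "der A k f \<Longrightarrow> der A (Suc k) (\<lambda>x. \<not> f x)"
| der_and: "der A k f \<Longrightarrow> der A l g \<Longrightarrow> der A (Suc (k + l)) (\<lambda>x. f x \<and> g x)"
| der_or: "der A k f \<Longrightarrow> der A l g \<Longrightarrow> der A (Suc (k + l)) (\<lambda>x. f x \<or> g x)"
| der_weaken: "der A k f \<Longrightarrow> k \<le> l \<Longrightarrow> der A l f"

text \<open>The superset \<open>B\<close> is general because the second operand of a binary gate is
  built on top of a circuit that already contains the first.\<close>

lemma ckt_der:
  assumes "der A k f" "ckt n B s" "A \<subseteq> B"
  shows "ckt n (insert f B) (s + k)"
  using assms
proof (induction arbitrary: B s rule: der.induct)
  case (der_base f)
  then show ?case by (simp add: insert_absorb subsetD)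
next
  case (der_const b)
  show ?case using ckt_const[OF der_const(1), of b] by simp
next
  case (der_not k f)
  have "ckt n (insert f B) (s + k)" by (rule der_not.IH) (use der_not.prems in auto)
  from ckt_not[OF this, of f] show ?case by (rule ckt_mono) auto
next
  case (der_and k f l g)
  have "ckt n (insert g (insert f B)) (s + k + l)"
    by (intro der_and.IH) (use der_and.prems in auto)
  from ckt_and_or(1)[OF this, of f g] show ?case by (rule ckt_mono) auto
next
  case (der_or k f l g)
  have "ckt n (insert g (insert f B)) (s + k + l)"
    by (intro der_or.IH) (use der_or.prems in auto)
  from ckt_and_or(2)[OF this, of f g] show ?case by (rule ckt_mono) auto
next
  case (der_weaken k f l)
  show ?case by (rule ckt_mono[OF der_weaken.IH[OF der_weaken.prems]]) (use der_weaken.hyps in auto)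
qed

lemma ckt_der_set:
  assumes "finite I" "\<And>i. i \<in> I \<Longrightarrow> der A k (F i)" "ckt n A s"
  shows "ckt n (A \<union> F ` I) (s + card I * k)"
  using assms(1,2)
proof (induction rule: finite_induct)
  case empty
  then show ?case using assms(3) by simp
next
  case (insert i I)
  have "ckt n (insert (F i) (A \<union> F ` I)) (s + card I * k + k)"
    by (rule ckt_der[of A]) (use insert in auto)
  then show ?case using insert by (simp add: ac_simps)
qed

text \<open>A chain of disjunctions: each member costs its own \<open>k\<close> gates and one
  \<open>GOr\<close>, and the chain ends in the constant \<open>False\<close>.\<close>

lemma der_bex:
  assumes "finite I" "\<And>i. i \<in> I \<Longrightarrow> der A k (F i)"
  shows "der A (card I * Suc k + 1) (\<lambda>x. \<exists>i\<in>I. F i x)"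
  using assms
proof (induction rule: finite_induct)
  case empty
  show ?case using der_const[of A False] by simp
next
  case (insert i I)
  have "der A (Suc (k + (card I * Suc k + 1))) (\<lambda>x. F i x \<or> (\<exists>i\<in>I. F i x))"
    by (rule der_or) (use insert in auto)
  then show ?case using insert by (simp add: ac_simps)
qed

lemma der_ball:
  assumes "finite I" "\<And>i. i \<in> I \<Longrightarrow> der A k (F i)"
  shows "der A (card I * Suc k + 1) (\<lambda>x. \<forall>i\<in>I. F i x)"
  using assms
proof (induction rule: finite_induct)
  case empty
  show ?case using der_const[of A True] by simp
next
  case (insert i I)
  have "der A (Suc (k + (card I * Suc k + 1))) (\<lambda>x. F i x \<and> (\<forall>i\<in>I. F i x))"
    by (rule der_and) (use insert in auto)
  then show ?case using insert by (simp add: ac_simps)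
qed

lemma ckt_inputs: "ckt n ({\<lambda>x. True, \<lambda>x. False} \<union> (\<lambda>i x. lk x i) ` {..<n}) (n + 2)"
proof -
  have "k \<le> n \<Longrightarrow> ckt n ({\<lambda>x. True, \<lambda>x. False} \<union> (\<lambda>i x. lk x i) ` {..<k}) (k + 2)" for k
  proof (induction k)
    case 0
    show ?case by (rule ckt_mono[OF ckt_const[OF ckt_const[OF ckt_empty], of n True False]]) auto
  next
    case (Suc k)
    then show ?case using ckt_input[of n _ "k + 2" k] by (auto simp: lessThan_Suc)
  qed
  then show ?thesis by blast
qed

text \<open>Feeding the functions \<open>F i\<close> into a gate list costs one gate per gate. The
  index \<open>j\<close> may run over all numbers because a wire past the end reads as
  \<open>False\<close>, which is why \<open>A\<close> has to contain that constant.\<close>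

lemma ckt_compose:
  assumes "ckt n A s" "(\<lambda>x. False) \<in> A" "\<And>i. i < k \<Longrightarrow> F i \<in> A"
  shows "ckt n (A \<union> (\<lambda>j x. lk (wires (map (\<lambda>i. F i x) [0..<k]) gs) j) ` UNIV) (s + length gs)"
proof (induction gs rule: rev_induct)
  case Nil
  show ?case by (rule ckt_mono[OF assms(1)]) (use assms(2) in \<open>auto simp: lk_def\<close>)
next
  case (snoc g gs)
  let ?y = "\<lambda>x. map (\<lambda>i. F i x) [0..<k]"
  let ?B = "A \<union> (\<lambda>j x. lk (wires (?y x) gs) j) ` UNIV"
  have "der ?B 1 (\<lambda>x. gate_val (?y x) (wires (?y x) gs) g)"
  proof (cases g)
    case (GIn i)
    have "(\<lambda>x. lk (?y x) i) \<in> A"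
    proof (cases "i < k")
      case True
      then show ?thesis using assms(3)[of i] by simp
    next
      case False
      then show ?thesis using assms(2) by (simp add: lk_def)
    qed
    then show ?thesis using GIn by (intro der_weaken[OF der_base]) simp_all
  next
    case (GConst b)
    then show ?thesis using der_const by simp
  next
    case (GNot i)
    then show ?thesis using GNot by simp (intro der_weaken[OF der_not[OF der_base]], simp_all)
  next
    case (GAnd i j)
    then show ?thesis using GAnd by simp (intro der_weaken[OF der_and[OF der_base der_base]], simp_all)
  next
    case (GOr i j)
    then show ?thesis using GOr by simp (intro der_weaken[OF der_or[OF der_base der_base]], simp_all)
  qed
  from ckt_der[OF this snoc]
  have *: "ckt n (insert (\<lambda>x. gate_val (?y x) (wires (?y x) gs) g) ?B) (s + length gs + 1)" by simp
  have "(\<lambda>x. lk (wires (?y x) (gs @ [g])) j) \<in> insert (\<lambda>x. gate_val (?y x) (wires (?y x) gs) g) ?B" for j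
  proof -
    consider "j < length gs" | "j = length gs" | "j > length gs" by linarith
    then show ?thesis
    proof cases
      case 1
      then have "(\<lambda>x. lk (wires (?y x) (gs @ [g])) j) = (\<lambda>x. lk (wires (?y x) gs) j)"
        by (simp add: lk_append)
      then show ?thesis by auto
    next
      case 2
      then show ?thesis by (simp add: lk_append)
    next
      case 3
      then show ?thesis using assms(2) by (simp add: lk_def)
    qed
  qed
  then show ?case by (intro ckt_mono[OF *]) auto
qed

section \<open>Circuits simulating machine steps\<close>

type_synonym transition = "nat \<times> nat \<times> nat \<times> nat \<times> int"

text \<open>One attempt at a single transition, switched on by the bit. Disabled or inapplicable attempts
  leave the configuration unchanged, so that every choice of bits describes a legal computation; going
  through all transitions once covers at least one machine step.\<close>
fun tau_step :: "transition \<Rightarrow> bool \<Rightarrow> config \<Rightarrow> config" where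
  "tau_step (q, a, q', b, mv) e (p, h, t) =
     (if e \<and> p = q \<and> t h = a then (q', h + mv, t(h := b)) else (p, h, t))"

definition run :: "(transition \<times> bfun) list \<Rightarrow> bool list \<Rightarrow> config \<Rightarrow> config" where
  "run ms x c = fold (\<lambda>(\<tau>, e). tau_step \<tau> (e x)) ms c"

lemma run_Nil [simp]: "run [] x c = c"
  by (simp add: run_def)

lemma run_Cons [simp]: "run ((\<tau>, e) # ms) x c = run ms x (tau_step \<tau> (e x) c)"
  by (simp add: run_def)

definition state_of :: "config \<Rightarrow> nat" where "state_of c = fst c"
definition head_of :: "config \<Rightarrow> int" where "head_of c = fst (snd c)"
definition tape_of :: "config \<Rightarrow> int \<Rightarrow> nat" where "tape_of c = snd (snd c)"

lemma config_simps [simp]: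
  "state_of (p, h, t) = p" "head_of (p, h, t) = h" "tape_of (p, h, t) = t"
  by (simp_all add: state_of_def head_of_def tape_of_def)

text \<open>A one-hot encoding of a configuration, limited to cells within distance \<open>R\<close>
  and to states and symbols up to \<open>S\<close>. A larger value shows as all of its bits being
  false and matches no transition satisfying \<open>ok_trans S\<close>, so new states and written
  symbols need no bound.\<close>

definition conf_funs :: "nat \<Rightarrow> nat \<Rightarrow> (bool list \<Rightarrow> config) \<Rightarrow> bfun set" where
  "conf_funs S R c = (\<lambda>p x. state_of (c x) = p) ` {..S} \<union>
     (\<lambda>i x. head_of (c x) = i) ` {- int R..int R} \<union>
     (\<lambda>(i, a) x. tape_of (c x) i = a) ` ({- int R..int R} \<times> {..S})"

lemma conf_funsD:
  assumes "conf_funs S R c \<subseteq> A"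
  shows "p \<le> S \<Longrightarrow> (\<lambda>x. state_of (c x) = p) \<in> A"
    and "\<bar>i\<bar> \<le> int R \<Longrightarrow> (\<lambda>x. head_of (c x) = i) \<in> A"
    and "\<bar>i\<bar> \<le> int R \<Longrightarrow> a \<le> S \<Longrightarrow> (\<lambda>x. tape_of (c x) i = a) \<in> A"
proof -
  have "(\<lambda>x. state_of (c x) = p) \<in> conf_funs S R c" if "p \<le> S"
    using that unfolding conf_funs_def by (intro UnI1 image_eqI) auto
  then show "p \<le> S \<Longrightarrow> (\<lambda>x. state_of (c x) = p) \<in> A" using assms by blast
  have "(\<lambda>x. head_of (c x) = i) \<in> conf_funs S R c" if "\<bar>i\<bar> \<le> int R"
    using that unfolding conf_funs_def by (intro UnI1[OF UnI2] image_eqI) auto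
  then show "\<bar>i\<bar> \<le> int R \<Longrightarrow> (\<lambda>x. head_of (c x) = i) \<in> A" using assms by blast
  have "(\<lambda>x. tape_of (c x) i = a) \<in> conf_funs S R c" if "\<bar>i\<bar> \<le> int R" "a \<le> S"
    using that unfolding conf_funs_def by (intro UnI2) (auto intro!: image_eqI[of _ _ "(i, a)"])
  then show "\<bar>i\<bar> \<le> int R \<Longrightarrow> a \<le> S \<Longrightarrow> (\<lambda>x. tape_of (c x) i = a) \<in> A" using assms by blast
qed

lemma ckt_conf_funs:
  assumes "ckt n A s"
    and "\<And>p. p \<le> S \<Longrightarrow> der A k (\<lambda>x. state_of (c x) = p)"
    and "\<And>i. \<bar>i\<bar> \<le> int R \<Longrightarrow> der A k (\<lambda>x. head_of (c x) = i)"
    and "\<And>i a. \<bar>i\<bar> \<le> int R \<Longrightarrow> a \<le> S \<Longrightarrow> der A k (\<lambda>x. tape_of (c x) i = a)"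
  shows "ckt n (A \<union> conf_funs S R c) (s + (S + 2 + 2 * R + (2 * R + 1) * (S + 1)) * k)"
proof -
  let ?F = "\<lambda>z. case z of Inl p \<Rightarrow> (\<lambda>x. state_of (c x) = p) | Inr (Inl i) \<Rightarrow> (\<lambda>x. head_of (c x) = i)
    | Inr (Inr (i, a)) \<Rightarrow> (\<lambda>x. tape_of (c x) i = a)"
  have card_R: "card {- int R..int R} = 2 * R + 1" by auto
  \<comment> \<open>The disjoint sum of the three index sets makes the gate count a single
    cardinality.\<close>
  let ?I = "{..S} <+> ({- int R..int R} <+> ({- int R..int R} \<times> {..S}))"
  have "der A k (?F z)" if "z \<in> ?I" for z
    using that assms(2-4) by (auto simp: abs_le_iff)
  from ckt_der_set[of ?I A k ?F, OF _ this assms(1)]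
  have 1: "ckt n (A \<union> ?F ` ?I) (s + card ?I * k)" by simp
  have 2: "conf_funs S R c \<subseteq> ?F ` ?I"
  proof -
    have "(\<lambda>x. state_of (c x) = p) \<in> ?F ` ?I" if "p \<le> S" for p
      using that by (intro image_eqI[of _ _ "Inl p"]) auto
    moreover have "(\<lambda>x. head_of (c x) = i) \<in> ?F ` ?I" if "i \<in> {- int R..int R}" for i
      using that by (intro image_eqI[of _ _ "Inr (Inl i)"]) auto
    moreover have "(\<lambda>x. tape_of (c x) i = a) \<in> ?F ` ?I" if "i \<in> {- int R..int R}" "a \<le> S" for i a
      using that by (intro image_eqI[of _ _ "Inr (Inr (i, a))"]) auto
    ultimately show ?thesis unfolding conf_funs_def by auto
  qed
  have 3: "card ?I = S + 2 + 2 * R + (2 * R + 1) * (S + 1)"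
    by (simp add: card_Plus card_cartesian_product card_R del: card_atLeastAtMost_int)
  show ?thesis by (rule ckt_mono[OF 1 Un_mono[OF order_refl 2]]) (simp only: 3)
qed

text \<open>The first summands pay for deciding whether a transition fires, the last one for
  updating each bit of \<open>conf_funs\<close> with at most 20 gates.\<close>

definition step_cost :: "nat \<Rightarrow> nat \<Rightarrow> nat" where
  "step_cost S R = 2 * (2 * R + 1) + 3 + (S + 2 + 2 * R + (2 * R + 1) * (S + 1)) * 20"

text \<open>The bit \<open>fire\<close> tells whether the transition applies; it is computed once,
  by searching the window for the head, and then shared by all updates. The strict bound on the head
  keeps it inside the window after the move.\<close>

lemma ckt_tau_step:
  assumes "ckt n A s" "conf_funs S R c \<subseteq> A" "e \<in> A"
    and "\<And>x. \<bar>head_of (c x)\<bar> < int R" "q \<le> S" "a \<le> S" "\<bar>mv\<bar> \<le> 1"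
  shows "ckt n (A \<union> conf_funs S R (\<lambda>x. tau_step (q, a, q', b, mv) (e x) (c x))) (s + step_cost S R)"
proof -
  let ?c' = "\<lambda>x. tau_step (q, a, q', b, mv) (e x) (c x)"
  note in_A = conf_funsD[OF assms(2)]
  have card_R: "card {- int R..int R} = 2 * R + 1" by auto
  define fire where "fire = (\<lambda>x. e x \<and> state_of (c x) = q \<and>
    (\<exists>i\<in>{- int R..int R}. head_of (c x) = i \<and> tape_of (c x) i = a))"
  have "der A 1 (\<lambda>x. head_of (c x) = i \<and> tape_of (c x) i = a)" if "i \<in> {- int R..int R}" for i
    using der_and[OF der_base der_base, OF in_A(2)[of i] in_A(3)[of i a]] assms that by (auto simp: abs_le_iff)
  then have "der A (card {- int R..int R} * Suc 1 + 1)
      (\<lambda>x. \<exists>i\<in>{- int R..int R}. head_of (c x) = i \<and> tape_of (c x) i = a)"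
    by (rule der_bex[OF finite_atLeastAtMost_int])
  then have "der A (2 * (2 * R + 1) + 1) (\<lambda>x. \<exists>i\<in>{- int R..int R}. head_of (c x) = i \<and> tape_of (c x) i = a)"
    by (rule der_weaken) (simp add: card_R del: card_atLeastAtMost_int)
  from der_and[OF der_base[OF assms(3)] der_and[OF der_base[OF in_A(1)[OF assms(5)]] this]]
  have "der A (2 * (2 * R + 1) + 3) fire" unfolding fire_def by (rule der_weaken) simp
  from ckt_der[OF this assms(1)]
  have ckt1: "ckt n (insert fire A) (s + (2 * (2 * R + 1) + 3))" by simp
  have fire: "fire x \<longleftrightarrow> e x \<and> state_of (c x) = q \<and> tape_of (c x) (head_of (c x)) = a" for x
    using assms(4)[of x] unfolding fire_def by (auto simp: abs_less_iff)
  let ?B = "insert fire A"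
  have fB: "der ?B 0 fire" by (rule der_base) simp
  have AB: "der ?B 0 f" if "f \<in> A" for f using that by (intro der_base) simp
  have st: "state_of (?c' x) = (if fire x then q' else state_of (c x))"
    and hd: "head_of (?c' x) = (if fire x then head_of (c x) + mv else head_of (c x))"
    and tp: "tape_of (?c' x) i = (if fire x \<and> head_of (c x) = i then b else tape_of (c x) i)" for x i
    by (cases "c x"; auto simp: fire)+
  have "ckt n (?B \<union> conf_funs S R ?c') (s + (2 * (2 * R + 1) + 3) + (S + 2 + 2 * R + (2 * R + 1) * (S + 1)) * 20)"
  proof (rule ckt_conf_funs[OF ckt1])
    fix p assume "p \<le> S"
    have "der ?B 20 (\<lambda>x. (\<not> fire x \<and> state_of (c x) = p) \<or> (fire x \<and> q' = p))"
      by (rule der_weaken[OF der_or[OF der_and[OF der_not[OF fB] AB[OF in_A(1)[OF \<open>p \<le> S\<close>]]]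
        der_and[OF fB der_const]]]) simp
    also have "(\<lambda>x. (\<not> fire x \<and> state_of (c x) = p) \<or> (fire x \<and> q' = p)) = (\<lambda>x. state_of (?c' x) = p)"
      by (auto simp: st)
    finally show "der ?B 20 (\<lambda>x. state_of (?c' x) = p)" .
  next
    fix i assume i: "\<bar>i\<bar> \<le> int R"
    \<comment> \<open>The head arrives at \<open>i\<close> from \<open>i - mv\<close>. If that cell
      lies outside the window, the head cannot be there and the bit is constantly false.\<close>
    have 1: "der ?B 1 (\<lambda>x. head_of (c x) = i - mv)"
    proof (cases "\<bar>i - mv\<bar> \<le> int R")
      case True
      then show ?thesis by (intro der_weaken[OF AB[OF in_A(2)]]) auto
    next
      case False
      then have "head_of (c x) \<noteq> i - mv" for x using assms(4)[of x] by auto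
      then show ?thesis using der_const by simp
    qed
    have "der ?B 20 (\<lambda>x. (\<not> fire x \<and> head_of (c x) = i) \<or> (fire x \<and> head_of (c x) = i - mv))"
      by (rule der_weaken[OF der_or[OF der_and[OF der_not[OF fB] AB[OF in_A(2)[OF i]]]
        der_and[OF fB 1]]]) simp
    also have "(\<lambda>x. (\<not> fire x \<and> head_of (c x) = i) \<or> (fire x \<and> head_of (c x) = i - mv))
        = (\<lambda>x. head_of (?c' x) = i)"
      by (auto simp: hd)
    finally show "der ?B 20 (\<lambda>x. head_of (?c' x) = i)" .
  next
    fix i a' assume i: "\<bar>i\<bar> \<le> int R" and a': "a' \<le> S"
    \<comment> \<open>Only the scanned cell changes, and only if the transition fires.\<close>
    have 1: "der ?B 1 (\<lambda>x. fire x \<and> head_of (c x) = i)"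
      using der_and[OF fB AB[OF in_A(2)[OF i]]] by simp
    have "der ?B 20 (\<lambda>x. (\<not> (fire x \<and> head_of (c x) = i) \<and> tape_of (c x) i = a') \<or>
       ((fire x \<and> head_of (c x) = i) \<and> b = a'))"
      by (rule der_weaken[OF der_or[OF der_and[OF der_not[OF 1] AB[OF in_A(3)[OF i a']]]
        der_and[OF 1 der_const]]]) simp
    also have "(\<lambda>x. (\<not> (fire x \<and> head_of (c x) = i) \<and> tape_of (c x) i = a') \<or>
       ((fire x \<and> head_of (c x) = i) \<and> b = a')) = (\<lambda>x. tape_of (?c' x) i = a')"
      by (auto simp: tp)
    finally show "der ?B 20 (\<lambda>x. tape_of (?c' x) i = a')" .
  qed
  then show ?thesis by (rule ckt_mono) (auto simp: step_cost_def)
qed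

definition ok_trans :: "nat \<Rightarrow> transition \<Rightarrow> bool" where
  "ok_trans S = (\<lambda>(q, a, q', b, mv). q \<le> S \<and> a \<le> S \<and> \<bar>mv\<bar> \<le> 1)"

text \<open>Each attempt moves the head by at most one cell, so the distance of the head plus the
  number of attempts left never grows.\<close>

lemma ckt_run:
  assumes "ckt n A s" "conf_funs S R c \<subseteq> A"
    and "\<And>x. \<bar>head_of (c x)\<bar> + int (length ms) \<le> int R"
    and "\<And>\<tau> e. (\<tau>, e) \<in> set ms \<Longrightarrow> ok_trans S \<tau> \<and> e \<in> A"
  shows "ckt n (A \<union> conf_funs S R (\<lambda>x. run ms x (c x))) (s + length ms * step_cost S R)"
  using assms
proof (induction ms arbitrary: A s c)
  case Nil
  then show ?case by (simp add: Un_absorb2)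
next
  case (Cons m ms)
  obtain q a q' b mv e where m: "m = ((q, a, q', b, mv), e)" by (metis surj_pair)
  then have ok: "q \<le> S" "a \<le> S" "\<bar>mv\<bar> \<le> 1" "e \<in> A"
    using Cons.prems(4)[of "(q, a, q', b, mv)" e] by (auto simp: ok_trans_def)
  let ?c' = "\<lambda>x. tau_step (q, a, q', b, mv) (e x) (c x)"
  let ?A' = "A \<union> conf_funs S R ?c'"
  have "ckt n ?A' (s + step_cost S R)"
  proof (rule ckt_tau_step[OF Cons.prems(1,2) ok(4) _ ok(1-3)])
    show "\<bar>head_of (c x)\<bar> < int R" for x using Cons.prems(3)[of x] by simp
  qed
  then have "ckt n (?A' \<union> conf_funs S R (\<lambda>x. run ms x (?c' x))) (s + step_cost S R + length ms * step_cost S R)"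
  proof (rule Cons.IH)
    show "\<bar>head_of (?c' x)\<bar> + int (length ms) \<le> int R" for x
      using Cons.prems(3)[of x] ok(3) by (cases "c x") (auto split: if_splits)
    show "ok_trans S \<tau> \<and> e \<in> ?A'" if "(\<tau>, e) \<in> set ms" for \<tau> e
      using Cons.prems(4)[of \<tau> e] that by auto
  qed auto
  then show ?case by (rule ckt_mono) (auto simp: m)
qed

text \<open>State, head and blank cells are constants. On an input cell the bit for symbol 2 is the
  input bit itself and the bit for symbol 1 is its negation.\<close>

lemma ckt_init:
  assumes "ckt n A s" "\<And>i. i < L \<Longrightarrow> W i \<in> A"
  shows "ckt n (A \<union> conf_funs S R (\<lambda>x. init_config M (map (\<lambda>i. W i x) [0..<L]))) (s + step_cost S R)"
proof -
  let ?c = "\<lambda>x. init_config M (map (\<lambda>i. W i x) [0..<L])"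
  have "ckt n (A \<union> conf_funs S R ?c) (s + (S + 2 + 2 * R + (2 * R + 1) * (S + 1)) * 1)"
  proof (rule ckt_conf_funs[OF assms(1)])
    show "der A 1 (\<lambda>x. state_of (?c x) = p)" "der A 1 (\<lambda>x. head_of (?c x) = i)" for p i
      using der_const[of A "start M = p"] der_const[of A "0 = i"] by (simp_all add: init_config_def)
    show "der A 1 (\<lambda>x. tape_of (?c x) i = a)" for i a
    proof (cases "0 \<le> i \<and> nat i < L")
      case True
      then have "(\<lambda>x. tape_of (?c x) i = a) = (\<lambda>x. bit_sym (W (nat i) x) = a)"
        by (auto simp: init_config_def)
      moreover have W: "W (nat i) \<in> A" using True assms(2) by blast
      moreover consider "a = 2" | "a = 1" | "a \<noteq> 1" "a \<noteq> 2" by blast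
      then have "der A 1 (\<lambda>x. bit_sym (W (nat i) x) = a)"
      proof cases
        case 1
        then have "(\<lambda>x. bit_sym (W (nat i) x) = a) = W (nat i)" by (auto simp: bit_sym_def fun_eq_iff)
        then show ?thesis using W by (intro der_weaken[OF der_base]) simp_all
      next
        case 2
        then have "(\<lambda>x. bit_sym (W (nat i) x) = a) = (\<lambda>x. \<not> W (nat i) x)"
          by (auto simp: bit_sym_def fun_eq_iff)
        then show ?thesis using W der_not[OF der_base, of _ A] by simp
      next
        case 3
        then have "(\<lambda>x. bit_sym (W (nat i) x) = a) = (\<lambda>x. False)"
          by (auto simp: bit_sym_def fun_eq_iff)
        then show ?thesis using der_const[of A False] by simp
      qed
      ultimately show ?thesis by simp
    next
      case False
      then have "(\<lambda>x. tape_of (?c x) i = a) = (\<lambda>x. 0 = a)" by (auto simp: init_config_def)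
      then show ?thesis using der_const[of A "0 = a"] by simp
    qed
  qed
  then show ?thesis by (rule ckt_mono) (auto simp: step_cost_def)
qed

lemma ckt_simulate:
  assumes "ckt n A s" "\<And>i. i < L \<Longrightarrow> W i \<in> A"
    and "length ms \<le> R" "\<And>\<tau> e. (\<tau>, e) \<in> set ms \<Longrightarrow> ok_trans S \<tau> \<and> e \<in> A"
  shows "ckt n (A \<union> conf_funs S R (\<lambda>x. run ms x (init_config M (map (\<lambda>i. W i x) [0..<L]))))
    (s + Suc (length ms) * step_cost S R)"
proof -
  let ?c = "\<lambda>x. init_config M (map (\<lambda>i. W i x) [0..<L])"
  have "ckt n (A \<union> conf_funs S R ?c \<union> conf_funs S R (\<lambda>x. run ms x (?c x)))
     (s + step_cost S R + length ms * step_cost S R)"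
    by (rule ckt_run[OF ckt_init[OF assms(1,2)]]) (use assms in \<open>auto simp: init_config_def\<close>)
  then show ?thesis by (rule ckt_mono) auto
qed

section \<open>Polynomial bounds\<close>

text \<open>With a base of at least 2, a power absorbs any constant factor or summand, so a single
  exponent replaces the coefficient and makes products and compositions easy.\<close>

lemma poly_bounded_iff: "poly_bounded f g \<longleftrightarrow> (\<exists>c. \<forall>n. f n \<le> (g n + 2) ^ c)"
proof
  assume "poly_bounded f g"
  then obtain c where c: "\<And>n. f n \<le> c * g n ^ c + c" unfolding poly_bounded_def by blast
  have "f n \<le> (g n + 2) ^ (2 * c + 1)" for n
  proof -
    let ?x = "(g n + 2) ^ c"
    \<comment> \<open>This turns the coefficient \<open>c\<close> into a power of the base.\<close>
    have "c \<le> 2 ^ c" by simp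
    also have "(2::nat) ^ c \<le> ?x" by (rule power_mono) auto
    finally have "c \<le> ?x" .
    moreover have "g n ^ c \<le> ?x" by (rule power_mono) auto
    ultimately have "c * g n ^ c + c \<le> ?x * ?x + ?x" by (intro add_mono mult_mono) auto
    also have "\<dots> \<le> ?x * ?x + ?x * ?x" by simp
    also have "\<dots> = 2 * (?x * ?x)" by simp
    also have "\<dots> \<le> (g n + 2) * (?x * ?x)" by (intro mult_mono) auto
    also have "\<dots> = (g n + 2) ^ (2 * c + 1)" by (simp add: mult_2 power_add)
    finally show ?thesis using c[of n] by simp
  qed
  then show "\<exists>c. \<forall>n. f n \<le> (g n + 2) ^ c" by blast
next
  assume "\<exists>c. \<forall>n. f n \<le> (g n + 2) ^ c"
  then obtain c where c: "\<And>n. f n \<le> (g n + 2) ^ c" by blast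
  \<comment> \<open>The definition wants one number as coefficient, exponent and summand. For
    \<open>g n > 0\<close> the base is at most \<open>3 * g n\<close>, and \<open>3 ^ c\<close> also
    exceeds the exponent \<open>c\<close>.\<close>
  have "f n \<le> 3 ^ c * g n ^ (3 ^ c) + 3 ^ c" for n
  proof (cases "g n = 0")
    case True
    then have "f n \<le> 2 ^ c" using c[of n] by (simp add: numeral_2_eq_2)
    also have "(2::nat) ^ c \<le> 3 ^ c" by (rule power_mono) auto
    finally show ?thesis by simp
  next
    case False
    have "c < 3 ^ c" by (rule power_gt_expt) simp
    have "f n \<le> (g n + 2) ^ c" by (rule c)
    also have "\<dots> \<le> (3 * g n) ^ c" using False by (intro power_mono) auto
    also have "\<dots> = 3 ^ c * g n ^ c" by (simp add: power_mult_distrib)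
    also have "\<dots> \<le> 3 ^ c * g n ^ (3 ^ c)"
      using False \<open>c < 3 ^ c\<close> by (intro mult_left_mono power_increasing) auto
    finally show ?thesis by simp
  qed
  then show "poly_bounded f g" unfolding poly_bounded_def by blast
qed

lemma poly_bounded_mono:
  assumes "poly_bounded g h" "\<And>n. f n \<le> g n"
  shows "poly_bounded f h"
  using assms unfolding poly_bounded_def by (meson le_trans)

lemma poly_bounded_trans:
  assumes "poly_bounded f g" "poly_bounded g h"
  shows "poly_bounded f h"
proof -
  obtain c where c: "\<And>n. f n \<le> (g n + 2) ^ c" using assms(1) unfolding poly_bounded_iff by blast
  obtain e where e: "\<And>n. g n \<le> (h n + 2) ^ e" using assms(2) unfolding poly_bounded_iff by blast
  have "f n \<le> (h n + 2) ^ ((e + 2) * c)" for n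
  proof -
    let ?x = "h n + 2"
    have "g n + 2 \<le> ?x ^ e + 2 ^ 1" using e[of n] by simp
    also have "2 ^ 1 \<le> ?x ^ 1" by (rule power_mono) auto
    also have "?x ^ e + ?x ^ 1 \<le> ?x ^ (e + 1) + ?x ^ (e + 1)"
      by (intro add_mono power_increasing) auto
    also have "\<dots> = 2 * ?x ^ (e + 1)" by simp
    also have "\<dots> \<le> ?x * ?x ^ (e + 1)" by (intro mult_right_mono) auto
    also have "\<dots> = ?x ^ (e + 2)" by simp
    finally have "(g n + 2) ^ c \<le> (?x ^ (e + 2)) ^ c" by (intro power_mono) auto
    then show ?thesis using c[of n] by (metis le_trans power_mult)
  qed
  then show ?thesis unfolding poly_bounded_iff by blast
qed

lemma poly_bounded_const: "poly_bounded (\<lambda>n. k) g"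
  unfolding poly_bounded_def by (intro exI[of _ k]) simp

lemma poly_bounded_self: "poly_bounded g g"
  unfolding poly_bounded_def by (intro exI[of _ 1]) simp

lemma poly_bounded_mult:
  assumes "poly_bounded f h" "poly_bounded g h"
  shows "poly_bounded (\<lambda>n. f n * g n) h"
proof -
  obtain c where c: "\<And>n. f n \<le> (h n + 2) ^ c" using assms(1) unfolding poly_bounded_iff by blast
  obtain e where e: "\<And>n. g n \<le> (h n + 2) ^ e" using assms(2) unfolding poly_bounded_iff by blast
  have "f n * g n \<le> (h n + 2) ^ (c + e)" for n
    unfolding power_add by (intro mult_mono c e) auto
  then show ?thesis unfolding poly_bounded_iff by blast
qed

lemma poly_bounded_Suc:
  assumes "poly_bounded f h"
  shows "poly_bounded (\<lambda>n. Suc (f n)) h"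
proof -
  obtain c where c: "\<And>n. f n \<le> c * h n ^ c + c" using assms unfolding poly_bounded_def by blast
  have "Suc (f n) \<le> (c + 1) * h n ^ (c + 1) + (c + 1)" for n
  proof -
    \<comment> \<open>The case \<open>c = 0\<close> is excluded because \<open>0 ^ 0 = 1\<close>
      exceeds \<open>0 ^ 1\<close>; there the factor \<open>c\<close> vanishes instead.\<close>
    have "h n ^ c \<le> h n ^ (c + 1)" if "c > 0"
      using that by (cases "h n = 0") (auto intro: power_increasing)
    then have "c * h n ^ c \<le> (c + 1) * h n ^ (c + 1)"
      by (cases "c = 0") (simp, intro mult_mono, auto)
    then show ?thesis using c[of n] by simp
  qed
  then show ?thesis unfolding poly_bounded_def by blast
qed

text \<open>A sum is at most the product of the two successors.\<close>

lemma poly_bounded_add: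
  assumes "poly_bounded f h" "poly_bounded g h"
  shows "poly_bounded (\<lambda>n. f n + g n) h"
  by (rule poly_bounded_mono[OF poly_bounded_mult[OF poly_bounded_Suc poly_bounded_Suc, OF assms]]) simp

lemma poly_bounded_power:
  assumes "poly_bounded f h"
  shows "poly_bounded (\<lambda>n. f n ^ k) h"
proof (induction k)
  case 0
  show ?case using poly_bounded_const[of 1] by simp
next
  case (Suc k)
  show ?case using poly_bounded_mult[OF assms Suc] by simp
qed

lemmas poly_bounded_intros = poly_bounded_add poly_bounded_mult poly_bounded_power
  poly_bounded_Suc poly_bounded_const poly_bounded_self

section \<open>Circuits for polynomial-time machines\<close>

definition runb :: "transition list \<Rightarrow> bool list \<Rightarrow> config \<Rightarrow> config" where
  "runb \<tau>s bs c = fold (\<lambda>(\<tau>, b). tau_step \<tau> b) (zip \<tau>s bs) c"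

lemma runb_Nil [simp]: "runb [] bs c = c"
  by (simp add: runb_def)

lemma runb_Cons [simp]: "runb (\<tau> # \<tau>s) (b # bs) c = runb \<tau>s bs (tau_step \<tau> b c)"
  by (simp add: runb_def)

lemma runb_append:
  "length bs = length \<tau>s \<Longrightarrow> runb (\<tau>s @ \<tau>s') (bs @ bs') c = runb \<tau>s' bs' (runb \<tau>s bs c)"
  by (simp add: runb_def)

lemma run_eq_runb: "run ms x c = runb (map fst ms) (map (\<lambda>(\<tau>, e). e x) ms) c"
proof (induction ms arbitrary: c)
  case (Cons m ms)
  then show ?case by (cases m) simp
qed simp

lemma tau_step_False [simp]: "tau_step \<tau> False c = c"
  by (cases \<tau>; cases c) simp

lemma runb_False [simp]: "runb \<tau>s (replicate (length \<tau>s) False) c = c"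
  by (induction \<tau>s) auto

lemma tau_step_cases:
  assumes "\<tau> \<in> trans M"
  shows "tau_step \<tau> b c = c \<or> step M c (tau_step \<tau> b c)"
proof -
  obtain q a q' b' mv where \<tau>: "\<tau> = (q, a, q', b', mv)" by (metis surj_pair)
  obtain p h t where c: "c = (p, h, t)" by (metis surj_pair)
  show ?thesis using assms unfolding \<tau> c step_def by auto
qed

lemma runb_reach:
  assumes "set \<tau>s \<subseteq> trans M" "length bs = length \<tau>s"
  shows "(step M)\<^sup>*\<^sup>* c (runb \<tau>s bs c)"
  using assms
proof (induction \<tau>s arbitrary: bs c)
  case Nil
  then show ?case by simp
next
  case (Cons \<tau> \<tau>s)
  then obtain b bs' where bs: "bs = b # bs'" by (cases bs) auto
  have "(step M)\<^sup>*\<^sup>* (tau_step \<tau> b c) (runb \<tau>s bs' (tau_step \<tau> b c))"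
    by (rule Cons.IH) (use Cons.prems bs in auto)
  moreover have "(step M)\<^sup>*\<^sup>* c (tau_step \<tau> b c)"
    using tau_step_cases[of \<tau> M b c] Cons.prems(1) by auto
  ultimately show ?case by (simp add: bs)
qed

text \<open>Completeness of one round: all attempts are switched off except the one that performs
  the given step.\<close>

lemma runb_step:
  assumes "step M c c'" "trans M \<subseteq> set \<tau>s"
  shows "\<exists>bs. length bs = length \<tau>s \<and> runb \<tau>s bs c = c'"
proof -
  obtain p h t where c: "c = (p, h, t)" by (metis surj_pair)
  from assms(1) obtain q' b mv where tr: "(p, t h, q', b, mv) \<in> trans M"
    and c': "c' = (q', h + mv, t(h := b))" unfolding step_def c by auto
  then obtain us vs where \<tau>s: "\<tau>s = us @ (p, t h, q', b, mv) # vs"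
    using assms(2) by (meson split_list subsetD)
  show ?thesis
    by (intro exI[of _ "replicate (length us) False @ True # replicate (length vs) False"])
      (simp add: \<tau>s runb_append c c')
qed

text \<open>Each step of the path takes one round; the remaining rounds are switched off, so any
  number of rounds from \<open>k\<close> on will do.\<close>

lemma runb_path:
  assumes "(step M ^^ k) c c'" "trans M \<subseteq> set \<tau>s" "k \<le> T"
  shows "\<exists>bs. length bs = length (concat (replicate T \<tau>s)) \<and> runb (concat (replicate T \<tau>s)) bs c = c'"
  using assms
proof (induction T arbitrary: k c)
  case 0
  then show ?case by simp
next
  case (Suc T)
  show ?case
  proof (cases k)
    case 0
    then show ?thesis using Suc.prems(1) by (metis length_replicate relpowp_0_E runb_False)
  next
    case (Suc l)
    then obtain c1 where "step M c c1" "(step M ^^ l) c1 c'"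
      using Suc.prems(1) by (metis relpowp_Suc_D2)
    moreover obtain bs where "length bs = length \<tau>s" "runb \<tau>s bs c = c1"
      using runb_step[OF \<open>step M c c1\<close> assms(2)] by blast
    moreover obtain bs' where "length bs' = length (concat (replicate T \<tau>s))"
        "runb (concat (replicate T \<tau>s)) bs' c1 = c'"
      using Suc.IH[OF \<open>(step M ^^ l) c1 c'\<close> assms(2)] Suc.prems(3) Suc by auto
    ultimately show ?thesis by (intro exI[of _ "bs @ bs'"]) (simp add: runb_append)
  qed
qed

section \<open>Halting, determinism and outputs\<close>

definition halted :: "ntm \<Rightarrow> config \<Rightarrow> bool" where
  "halted M c \<longleftrightarrow> (\<forall>c'. \<not> step M c c')"

text \<open>With every switch on, each applicable attempt is a genuine step. If none was taken, the
  configuration never changed, so every test was made against \<open>c\<close> itself.\<close>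

lemma runb_True_round:
  assumes "set \<tau>s \<subseteq> trans M"
  shows "\<exists>j. (step M ^^ j) c (runb \<tau>s (replicate (length \<tau>s) True) c) \<and>
    (j = 0 \<longrightarrow> (\<forall>\<tau>\<in>set \<tau>s. \<not> (fst \<tau> = state_of c \<and> fst (snd \<tau>) = tape_of c (head_of c))))"
  using assms
proof (induction \<tau>s arbitrary: c)
  case Nil
  then show ?case by (intro exI[of _ 0]) simp
next
  case (Cons \<tau> \<tau>s)
  obtain q a q' b mv where \<tau>: "\<tau> = (q, a, q', b, mv)" by (metis surj_pair)
  obtain p h t where c: "c = (p, h, t)" by (metis surj_pair)
  show ?case
  proof (cases "p = q \<and> t h = a")
    case True
    then have "step M c (tau_step \<tau> True c)" using Cons.prems unfolding \<tau> c step_def by auto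
    moreover obtain j where "(step M ^^ j) (tau_step \<tau> True c)
        (runb \<tau>s (replicate (length \<tau>s) True) (tau_step \<tau> True c))"
      using Cons.IH[of "tau_step \<tau> True c"] Cons.prems by auto
    ultimately have "(step M ^^ Suc j) c (runb \<tau>s (replicate (length \<tau>s) True) (tau_step \<tau> True c))"
      by (metis relpowp_Suc_I2)
    then show ?thesis by (intro exI[of _ "Suc j"]) simp
  next
    case False
    then have "tau_step \<tau> True c = c" by (auto simp: \<tau> c)
    moreover obtain j where "(step M ^^ j) c (runb \<tau>s (replicate (length \<tau>s) True) c)"
      "j = 0 \<longrightarrow> (\<forall>\<tau>\<in>set \<tau>s. \<not> (fst \<tau> = state_of c \<and> fst (snd \<tau>) = tape_of c (head_of c)))"
      using Cons.IH[of c] Cons.prems by auto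
    ultimately show ?thesis using False by (intro exI[of _ j]) (auto simp: \<tau> c)
  qed
qed

lemma runb_True_round_cases:
  assumes "set \<tau>s = trans M"
  shows "\<exists>j. (step M ^^ j) c (runb \<tau>s (replicate (length \<tau>s) True) c) \<and> (j = 0 \<longrightarrow> halted M c)"
proof -
  have "set \<tau>s \<subseteq> trans M" using assms by simp
  from runb_True_round[OF this, of c] obtain j where j:
    "(step M ^^ j) c (runb \<tau>s (replicate (length \<tau>s) True) c)"
    "j = 0 \<longrightarrow> (\<forall>\<tau>\<in>trans M. \<not> (fst \<tau> = state_of c \<and> fst (snd \<tau>) = tape_of c (head_of c)))"
    unfolding assms by (elim exE conjE)
  have "halted M c" if "j = 0"
  proof -
    obtain p h t where c: "c = (p, h, t)" by (metis surj_pair)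
    have *: "\<forall>\<tau>\<in>trans M. \<not> (fst \<tau> = p \<and> fst (snd \<tau>) = t h)" using j(2) that by (simp add: c)
    then show ?thesis unfolding halted_def step_def c by force
  qed
  with j(1) show ?thesis by (intro exI[of _ j] conjI impI)
qed

text \<open>A round either makes progress or starts in a halted configuration, where everything
  stays. Hence after \<open>T\<close> rounds at least \<open>T\<close> steps were made or the run
  has halted.\<close>

lemma runb_True_rounds:
  assumes "set \<tau>s = trans M"
  shows "\<exists>j. (step M ^^ j) c (runb (concat (replicate T \<tau>s)) (replicate (T * length \<tau>s) True) c) \<and>
    (j \<ge> T \<or> halted M (runb (concat (replicate T \<tau>s)) (replicate (T * length \<tau>s) True) c))"
proof (induction T arbitrary: c)
  case 0
  show ?case by (intro exI[of _ 0]) simp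
next
  case (Suc T)
  let ?c = "runb \<tau>s (replicate (length \<tau>s) True) c"
  let ?r = "runb (concat (replicate T \<tau>s)) (replicate (T * length \<tau>s) True)"
  obtain i where i: "(step M ^^ i) c ?c" "i = 0 \<longrightarrow> halted M c"
    using runb_True_round_cases[OF assms] by blast
  obtain j where j: "(step M ^^ j) ?c (?r ?c)" "j \<ge> T \<or> halted M (?r ?c)" using Suc by blast
  have eq: "runb (concat (replicate (Suc T) \<tau>s)) (replicate (Suc T * length \<tau>s) True) c = ?r ?c"
    by (simp add: replicate_add runb_append)
  have ij: "(step M ^^ (i + j)) c (?r ?c)" using i(1) j(1) by (auto simp: relpowp_add)
  have "i + j \<ge> Suc T \<or> halted M (?r ?c)"
  proof (cases "i = 0")
    case True
    then have "halted M c" "?c = c" using i by auto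
    \<comment> \<open>From a halted configuration only the path of length zero exists.\<close>
    moreover from this have "?r ?c = c"
      using j(1) unfolding halted_def by (metis not0_implies_Suc relpowp_0_E relpowp_Suc_D2)
    ultimately show ?thesis by simp
  next
    case False
    then show ?thesis using j(2) by auto
  qed
  then show ?case using ij unfolding eq by blast
qed

lemma deterministic_step:
  assumes "deterministic M" "step M c c1" "step M c c2"
  shows "c1 = c2"
  using assms unfolding deterministic_def step_def by (cases c) blast

text \<open>Both paths must take the same first step, and neither can stop before the other.\<close>

lemma deterministic_halted_unique:
  assumes "deterministic M" "(step M)\<^sup>*\<^sup>* c a" "(step M)\<^sup>*\<^sup>* c b" "halted M a" "halted M b"
  shows "a = b"
  using assms(2,3)
proof (induction rule: converse_rtranclp_induct)
  case base
  then show ?case using assms(4) unfolding halted_def by (metis converse_rtranclpE)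
next
  case (step y z)
  from step.prems show ?case
  proof (cases rule: converse_rtranclpE)
    case base
    then show ?thesis using step.hyps(1) assms(5) unfolding halted_def by blast
  next
    case (step z')
    then show ?thesis using step.IH deterministic_step[OF assms(1)] \<open>step M y z\<close> by blast
  qed
qed

lemma halted_accept: "ntm_wf M \<Longrightarrow> halted M (accept M, h, t)"
  unfolding halted_def step_def ntm_wf_def by fastforce

text \<open>A step alters one cell. Finiteness ensures that some cell to the right of the origin
  carries no bit symbol, so that the \<open>LEAST\<close> in \<open>tape_output\<close> is
  attained.\<close>

lemma finite_tape_reach:
  assumes "(step M)\<^sup>*\<^sup>* (init_config M w) c"
  shows "finite {i. tape_of c i \<noteq> 0}"
  using assms
proof (induction rule: rtranclp_induct)
  case base
  have "{i. tape_of (init_config M w) i \<noteq> 0} \<subseteq> {0..int (length w)}"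
    by (auto simp: init_config_def split: if_splits)
  then show ?case by (rule finite_subset) simp
next
  case (step y z)
  obtain p h t where y: "y = (p, h, t)" by (metis surj_pair)
  with step.hyps(2) obtain b where "tape_of z = t(h := b)" unfolding step_def by auto
  then have "{i. tape_of z i \<noteq> 0} \<subseteq> insert h {i. tape_of y i \<noteq> 0}" by (auto simp: y)
  then show ?case by (rule finite_subset) (use step.IH in simp)
qed

text \<open>A cell-by-cell form of \<open>tape_output\<close> that a circuit can test, including the
  end of the output.\<close>

definition outputs :: "(int \<Rightarrow> nat) \<Rightarrow> bool list \<Rightarrow> bool" where
  "outputs t y \<longleftrightarrow> (\<forall>j<length y. t (int j) = (if y ! j then 2 else 1)) \<and>
     t (int (length y)) \<noteq> 1 \<and> t (int (length y)) \<noteq> 2"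

lemma tape_output_iff:
  assumes "finite {i. t i \<noteq> 0}"
  shows "tape_output t = y \<longleftrightarrow> outputs t y"
proof
  assume y: "tape_output t = y"
  let ?P = "\<lambda>j::nat. t (int j) \<notin> {1, 2}"
  let ?L = "LEAST j. ?P j"
  have "\<exists>j. ?P j"
  proof (rule ccontr)
    assume "\<not> (\<exists>j. ?P j)"
    then have "t (int j) \<noteq> 0" for j by (metis insertE empty_iff zero_neq_one zero_neq_numeral)
    then have "range int \<subseteq> {i. t i \<noteq> 0}" by auto
    then have "finite (range int)" using assms finite_subset by blast
    then show False by (simp add: finite_image_iff inj_on_def)
  qed
  then have 1: "?P ?L" by (rule LeastI_ex)
  have 2: "t (int j) \<in> {1, 2}" if "j < ?L" for j using not_less_Least[OF that] by blast
  have "y = map (\<lambda>j. t (int j) = 2) [0..<?L]" using y by (simp add: tape_output_def Let_def)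
  then show "outputs t y" using 1 2 unfolding outputs_def by fastforce
next
  assume y: "outputs t y"
  have "(LEAST j::nat. t (int j) \<notin> {1, 2}) = length y"
  proof (rule Least_equality)
    show "t (int (length y)) \<notin> {1, 2}" using y by (auto simp: outputs_def)
    show "length y \<le> j" if "t (int j) \<notin> {1, 2}" for j
      using y that unfolding outputs_def by (metis insertCI not_less)
  qed
  then show "tape_output t = y"
    using y by (auto simp: tape_output_def outputs_def intro!: nth_equalityI split: if_splits)
qed

lemma accepts_with_iff:
  "accepts_with M w y \<longleftrightarrow>
     (\<exists>c. (step M)\<^sup>*\<^sup>* (init_config M w) c \<and> state_of c = accept M \<and> outputs (tape_of c) y)"
proof
  assume "accepts_with M w y"
  then obtain h t where r: "(step M)\<^sup>*\<^sup>* (init_config M w) (accept M, h, t)" and y: "tape_output t = y"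
    unfolding accepts_with_def by auto
  from y finite_tape_reach[OF r] have "outputs t y" by (simp add: tape_output_iff)
  with r show "\<exists>c. (step M)\<^sup>*\<^sup>* (init_config M w) c \<and> state_of c = accept M \<and> outputs (tape_of c) y"
    by (intro exI[of _ "(accept M, h, t)"]) simp
next
  assume "\<exists>c. (step M)\<^sup>*\<^sup>* (init_config M w) c \<and> state_of c = accept M \<and> outputs (tape_of c) y"
  then obtain c where r: "(step M)\<^sup>*\<^sup>* (init_config M w) c" and c: "state_of c = accept M" "outputs (tape_of c) y"
    by blast
  obtain q h t where q: "c = (q, h, t)" by (metis surj_pair)
  from finite_tape_reach[OF r] c(2) have "tape_output t = y" by (simp add: q tape_output_iff)
  with r c(1) show "accepts_with M w y" unfolding accepts_with_def by (auto simp: q)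
qed

text \<open>The bound covers what a simulation has to test: the states and symbols read by
  transitions, the accepting state and the two bit symbols.\<close>

lemma ntm_wf_bound:
  assumes "ntm_wf M"
  shows "\<exists>S. (\<forall>\<tau>\<in>trans M. ok_trans S \<tau>) \<and> accept M \<le> S \<and> 2 \<le> S"
proof -
  let ?f = "\<lambda>(q, a, q', b, mv). max q a"
  have fin: "finite (?f ` trans M)" using assms unfolding ntm_wf_def by simp
  let ?S = "Max (insert (accept M) (insert 2 (?f ` trans M)))"
  have "ok_trans ?S \<tau>" if "\<tau> \<in> trans M" for \<tau>
  proof -
    obtain q a q' b mv where \<tau>: "\<tau> = (q, a, q', b, mv)" by (metis surj_pair)
    have "max q a \<in> ?f ` trans M" using that unfolding \<tau> by (intro image_eqI[OF _ that[unfolded \<tau>]]) simp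
    then have "max q a \<le> ?S" using fin by (intro Max_ge) auto
    moreover have "mv \<in> {-1, 0, 1}" using that assms unfolding \<tau> ntm_wf_def by fastforce
    ultimately show ?thesis by (auto simp: ok_trans_def \<tau>)
  qed
  moreover have "accept M \<le> ?S" "2 \<le> ?S" using fin by (intro Max_ge; simp)+
  ultimately show ?thesis by blast
qed

text \<open>One more than the time bound, so that a run cannot make a step in every round.\<close>

definition rounds :: "nat \<Rightarrow> nat \<Rightarrow> nat" where
  "rounds c L = Suc (c * L ^ c + c)"

text \<open>\<open>K\<close> is the number of transitions tried per round; \<open>Suc\<close>
  accounts for the initial configuration. The window is widened by \<open>m\<close> so that it
  contains the output cells and the cell that ends the output.\<close>

definition sim_cost :: "nat \<Rightarrow> nat \<Rightarrow> nat \<Rightarrow> nat \<Rightarrow> nat \<Rightarrow> nat" where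
  "sim_cost c K S L m = Suc (rounds c L * K) * step_cost S (rounds c L * K + m)"

lemma poly_bounded_rounds:
  assumes "poly_bounded L h"
  shows "poly_bounded (\<lambda>n. rounds c (L n)) h"
  unfolding rounds_def by (intro poly_bounded_intros assms)

lemma poly_bounded_sim_cost:
  assumes "poly_bounded L h" "poly_bounded m h"
  shows "poly_bounded (\<lambda>n. sim_cost c K S (L n) (m n)) h"
  unfolding sim_cost_def step_cost_def
  by (intro poly_bounded_intros poly_bounded_rounds assms)

text \<open>All switches are constantly true. The run halts within the given rounds, the accepting
  configuration is halted too, and determinism identifies the two. The constants depend on
  \<open>M\<close> alone, which keeps the cost polynomial along a family of inputs.\<close>

lemma ckt_deterministic:
  assumes "ntm_wf M" "deterministic M" "poly_time M"
  shows "\<exists>c K S. \<forall>k A s L W m f. ckt k A s \<longrightarrow> (\<lambda>x. True) \<in> A \<longrightarrow> (\<forall>i<L. W i \<in> A) \<longrightarrow>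
    (\<forall>x. length (f x) = m \<and> accepts_with M (map (\<lambda>i. W i x) [0..<L]) (f x)) \<longrightarrow>
    ckt k (A \<union> (\<lambda>j x. f x ! j) ` {..<m}) (s + sim_cost c K S L m)"
proof -
  obtain S where S: "\<forall>\<tau>\<in>trans M. ok_trans S \<tau>" "2 \<le> S" using ntm_wf_bound[OF assms(1)] by blast
  obtain \<tau>s where \<tau>s: "set \<tau>s = trans M" using assms(1) finite_list unfolding ntm_wf_def by blast
  obtain c where c: "\<And>w k c'. (step M ^^ k) (init_config M w) c' \<Longrightarrow> k \<le> c * length w ^ c + c"
    using assms(3) unfolding poly_time_def by blast
  let ?K = "length \<tau>s"
  have "ckt k (A \<union> (\<lambda>j x. f x ! j) ` {..<m}) (s + sim_cost c ?K S L m)"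
    if ckt: "ckt k A s" and T: "(\<lambda>x. True) \<in> A" and W: "\<forall>i<L. W i \<in> A"
      and f: "\<forall>x. length (f x) = m \<and> accepts_with M (map (\<lambda>i. W i x) [0..<L]) (f x)" for k A s L W m f
  proof -
    let ?w = "\<lambda>x. map (\<lambda>i. W i x) [0..<L]"
    let ?T = "rounds c L"
    let ?R = "?T * ?K + m"
    define ms :: "(transition \<times> bfun) list" where
      "ms = map (\<lambda>\<tau>. (\<tau>, \<lambda>x. True)) (concat (replicate ?T \<tau>s))"
    let ?c = "\<lambda>x. run ms x (init_config M (?w x))"
    have len: "length (concat (replicate ?T \<tau>s)) = ?T * ?K" by (simp add: length_concat sum_list_replicate)
    have sim: "ckt k (A \<union> conf_funs S ?R ?c) (s + Suc (length ms) * step_cost S ?R)"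
    proof (rule ckt_simulate[OF ckt])
      show "W i \<in> A" if "i < L" for i using W that by blast
      show "length ms \<le> ?R" by (simp add: ms_def len)
      show "ok_trans S \<tau> \<and> e \<in> A" if "(\<tau>, e) \<in> set ms" for \<tau> e
      proof -
        have "\<tau> \<in> trans M" "e = (\<lambda>x. True)"
          using that unfolding ms_def \<tau>s[symmetric] by (auto split: if_splits)
        then show ?thesis using T S(1) by blast
      qed
    qed
    have "outputs (tape_of (?c x)) (f x)" for x
    proof -
      let ?r = "runb (concat (replicate ?T \<tau>s)) (replicate (?T * ?K) True) (init_config M (?w x))"
      have run: "?c x = ?r"
        by (simp add: run_eq_runb ms_def o_def map_replicate_const len)
      obtain j where j: "(step M ^^ j) (init_config M (?w x)) ?r" "j \<ge> ?T \<or> halted M ?r"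
        using runb_True_rounds[OF \<tau>s] by blast
      \<comment> \<open>The time bound rules out \<open>j \<ge> ?T\<close>.\<close>
      then have "halted M ?r" using c[OF j(1)] by (auto simp: rounds_def)
      moreover obtain a where a: "(step M)\<^sup>*\<^sup>* (init_config M (?w x)) a" "state_of a = accept M"
          "outputs (tape_of a) (f x)"
        using f unfolding accepts_with_iff by blast
      moreover have "halted M a" using halted_accept[OF assms(1)] a(2) by (cases a) auto
      moreover have "(step M)\<^sup>*\<^sup>* (init_config M (?w x)) ?r" using j(1) by (rule relpowp_imp_rtranclp)
      ultimately have "?r = a" using deterministic_halted_unique[OF assms(2)] by blast
      then show ?thesis using a(3) run by simp
    qed
    then have "(\<lambda>x. f x ! j) = (\<lambda>x. tape_of (?c x) (int j) = 2)" if "j < m" for j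
      using f that unfolding outputs_def by fastforce
    moreover have "(\<lambda>x. tape_of (?c x) (int j) = 2) \<in> conf_funs S ?R ?c" if "j < m" for j
      using that S(2) by (intro conf_funsD(3)) auto
    ultimately have "(\<lambda>j x. f x ! j) ` {..<m} \<subseteq> conf_funs S ?R ?c" by auto
    then show ?thesis
      by (intro ckt_mono[OF sim]) (auto simp: sim_cost_def ms_def len)
  qed
  then show ?thesis by blast
qed

text \<open>The switches are input bits from position \<open>off\<close> on and serve as the
  witness. Any values describe a legal computation, which gives soundness. For completeness they
  must be free to follow a given accepting path, so the word and the claimed output may not depend
  on them.\<close>

lemma ckt_nondeterministic:
  assumes "ntm_wf M" "poly_time M"
  shows "\<exists>c K S. \<forall>k A s L W m Y off. ckt k A s \<longrightarrow> (\<forall>i<L. W i \<in> A) \<longrightarrow> (\<forall>j<m. Y j \<in> A) \<longrightarrow>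
    (\<forall>j<rounds c L * K. (\<lambda>x. lk x (off + j)) \<in> A) \<longrightarrow>
    (\<exists>f. ckt k (insert f A) (s + sim_cost c K S L m + (m * 5 + 10)) \<and>
      (\<forall>x. f x \<longrightarrow> accepts_with M (map (\<lambda>i. W i x) [0..<L]) (map (\<lambda>j. Y j x) [0..<m])) \<and>
      (\<forall>u w y. length u = off \<longrightarrow> accepts_with M w y \<longrightarrow>
         (\<forall>e. map (\<lambda>i. W i (u @ e)) [0..<L] = w \<and> map (\<lambda>j. Y j (u @ e)) [0..<m] = y) \<longrightarrow>
         (\<exists>e. length e = rounds c L * K \<and> f (u @ e))))"
proof -
  obtain S where S: "\<forall>\<tau>\<in>trans M. ok_trans S \<tau>" "accept M \<le> S" "2 \<le> S"
    using ntm_wf_bound[OF assms(1)] by blast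
  obtain \<tau>s where \<tau>s: "set \<tau>s = trans M" using assms(1) finite_list unfolding ntm_wf_def by blast
  obtain c where c: "\<And>w k c'. (step M ^^ k) (init_config M w) c' \<Longrightarrow> k \<le> c * length w ^ c + c"
    using assms(2) unfolding poly_time_def by blast
  let ?K = "length \<tau>s"
  have "\<exists>f. ckt k (insert f A) (s + sim_cost c ?K S L m + (m * 5 + 10)) \<and>
      (\<forall>x. f x \<longrightarrow> accepts_with M (map (\<lambda>i. W i x) [0..<L]) (map (\<lambda>j. Y j x) [0..<m])) \<and>
      (\<forall>u w y. length u = off \<longrightarrow> accepts_with M w y \<longrightarrow>
         (\<forall>e. map (\<lambda>i. W i (u @ e)) [0..<L] = w \<and> map (\<lambda>j. Y j (u @ e)) [0..<m] = y) \<longrightarrow>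
         (\<exists>e. length e = rounds c L * ?K \<and> f (u @ e)))"
    if ckt: "ckt k A s" and W: "\<forall>i<L. W i \<in> A" and Y: "\<forall>j<m. Y j \<in> A"
      and E: "\<forall>j<rounds c L * ?K. (\<lambda>x. lk x (off + j)) \<in> A" for k A s L W m Y off
  proof -
    let ?w = "\<lambda>x. map (\<lambda>i. W i x) [0..<L]"
    let ?y = "\<lambda>x. map (\<lambda>j. Y j x) [0..<m]"
    let ?T = "rounds c L"
    let ?R = "?T * ?K + m"
    let ?\<sigma> = "concat (replicate ?T \<tau>s)"
    define ms :: "(transition \<times> bfun) list" where
      "ms = zip ?\<sigma> (map (\<lambda>j x. lk x (off + j)) [0..<?T * ?K])"
    let ?c = "\<lambda>x. run ms x (init_config M (?w x))"
    define f where "f = (\<lambda>x. state_of (?c x) = accept M \<and> outputs (tape_of (?c x)) (?y x))"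
    have len: "length ?\<sigma> = ?T * ?K" by (simp add: length_concat sum_list_replicate)
    have sub: "set ?\<sigma> \<subseteq> trans M" using \<tau>s by auto
    have run: "?c x = runb ?\<sigma> (map (\<lambda>j. lk x (off + j)) [0..<?T * ?K]) (init_config M (?w x))" for x
    proof -
      have "map fst ms = ?\<sigma>" by (simp add: ms_def len)
      moreover have "map (\<lambda>(\<tau>, e). e x) ms = map (\<lambda>j. lk x (off + j)) [0..<?T * ?K]"
        by (rule nth_equalityI) (simp_all add: ms_def len)
      ultimately show ?thesis by (simp only: run_eq_runb)
    qed
    let ?A = "A \<union> conf_funs S ?R ?c"
    have sim: "ckt k ?A (s + Suc (length ms) * step_cost S ?R)"
    proof (rule ckt_simulate[OF ckt])
      show "W i \<in> A" if "i < L" for i using W that by blast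
      show "length ms \<le> ?R" by (simp add: ms_def len)
      show "ok_trans S \<tau> \<and> e \<in> A" if "(\<tau>, e) \<in> set ms" for \<tau> e
      proof
        show "ok_trans S \<tau>" using set_zip_leftD[OF that[unfolded ms_def]] sub S(1) by blast
        show "e \<in> A" using set_zip_rightD[OF that[unfolded ms_def]] E by auto
      qed
    qed
    note in_A = conf_funsD[of S ?R ?c ?A, OF Un_upper2]
    have tape: "der ?A 0 (\<lambda>x. tape_of (?c x) (int j) = a)" if "j \<le> m" "a \<le> 2" for j a
      by (intro der_base in_A(3)) (use that S(3) in \<open>simp_all only: abs_of_nat of_nat_le_iff trans_le_add2 le_trans[of a 2 S]\<close>)
    have "der ?A 4 (\<lambda>x. tape_of (?c x) (int j) = (if Y j x then 2 else 1))" if "j < m" for j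
    proof -
      have y: "der ?A 0 (Y j)" using Y that by (intro der_base) auto
      have eq: "(\<lambda>x. tape_of (?c x) (int j) = (if Y j x then 2 else 1)) =
        (\<lambda>x. (tape_of (?c x) (int j) = 2 \<and> Y j x) \<or> (tape_of (?c x) (int j) = 1 \<and> \<not> Y j x))"
        by (auto simp: fun_eq_iff)
      show ?thesis
        unfolding eq by (rule der_weaken[OF der_or[OF der_and[OF tape[of j 2] y] der_and[OF tape[of j 1] der_not[OF y]]]])
          (use that in auto)
    qed
    then have bits: "der ?A (card {..<m} * Suc 4 + 1)
        (\<lambda>x. \<forall>j\<in>{..<m}. tape_of (?c x) (int j) = (if Y j x then 2 else 1))"
      by (intro der_ball) auto
    \<comment> \<open>Cell \<open>m\<close> has to be free of bit symbols, as the output would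
      otherwise be longer than \<open>m\<close>.\<close>
    have "der ?A (m * 5 + 10) (\<lambda>x. state_of (?c x) = accept M \<and>
        (\<forall>j\<in>{..<m}. tape_of (?c x) (int j) = (if Y j x then 2 else 1)) \<and>
        \<not> tape_of (?c x) (int m) = 1 \<and> \<not> tape_of (?c x) (int m) = 2)"
      by (rule der_weaken[OF der_and[OF der_base[OF in_A(1)[OF S(2)]] der_and[OF bits
        der_and[OF der_not[OF tape[of m 1]] der_not[OF tape[of m 2]]]]]]) auto
    moreover have "(\<lambda>x. state_of (?c x) = accept M \<and>
        (\<forall>j\<in>{..<m}. tape_of (?c x) (int j) = (if Y j x then 2 else 1)) \<and>
        \<not> tape_of (?c x) (int m) = 1 \<and> \<not> tape_of (?c x) (int m) = 2) = f"
      unfolding f_def outputs_def by (auto simp: fun_eq_iff)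
    ultimately have "der ?A (m * 5 + 10) f" by simp
    from ckt_der[OF this sim order_refl]
    have "ckt k (insert f A) (s + sim_cost c ?K S L m + (m * 5 + 10))"
      by (rule ckt_mono) (auto simp: sim_cost_def ms_def len)
    moreover have "accepts_with M (?w x) (?y x)" if "f x" for x
    proof -
      have "(step M)\<^sup>*\<^sup>* (init_config M (?w x)) (?c x)"
        unfolding run by (rule runb_reach[OF sub]) (simp add: len)
      then show ?thesis using that unfolding accepts_with_iff f_def by blast
    qed
    moreover have "\<exists>e. length e = ?T * ?K \<and> f (u @ e)"
      if u: "length u = off" and acc: "accepts_with M w y" and wy: "\<forall>e. ?w (u @ e) = w \<and> ?y (u @ e) = y"
      for u w y
    proof -
      obtain a where a: "(step M)\<^sup>*\<^sup>* (init_config M w) a" "state_of a = accept M" "outputs (tape_of a) y"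
        using acc unfolding accepts_with_iff by blast
      then obtain l where l: "(step M ^^ l) (init_config M w) a" by (metis rtranclp_imp_relpowp)
      have "length w = L" using wy by auto
      then have "l \<le> ?T" using c[OF l] by (simp add: rounds_def)
      then obtain e where e: "length e = ?T * ?K" "runb ?\<sigma> e (init_config M w) = a"
        using runb_path[OF l, of \<tau>s ?T] \<tau>s len by auto
      \<comment> \<open>As \<open>u\<close> has length \<open>off\<close>, the switches read exactly
        \<open>e\<close>.\<close>
      have "map (\<lambda>j. lk (u @ e) (off + j)) [0..<?T * ?K] = e"
        using u e(1) by (intro nth_equalityI) (auto simp: lk_append)
      then have "?c (u @ e) = a" using e(2) wy unfolding run by simp
      then have "f (u @ e)" using a wy unfolding f_def by simp
      then show ?thesis using e(1) by blast
    qed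
    ultimately show ?thesis by (intro exI[of _ f] conjI allI impI)
  qed
  then show ?thesis by (intro exI[of _ c] exI[of _ ?K] exI[of _ S] allI impI)
qed

section \<open>Circuit encodings and hardwired inputs\<close>

declare bin.simps [simp del]

lemma bin_0 [simp]: "bin 0 = []"
  by (simp add: bin.simps)

lemma bin_pos: "n > 0 \<Longrightarrow> bin n = odd n # bin (n div 2)"
  by (simp add: bin.simps)

lemma bin_inj: "bin a = bin b \<Longrightarrow> a = b"
proof (induction a arbitrary: b rule: less_induct)
  case (less a)
  show ?case
  proof (cases "a = 0 \<or> b = 0")
    case True
    then show ?thesis using less.prems bin_pos[of a] bin_pos[of b] by (cases "a = 0"; cases "b = 0") auto
  next
    case False
    then have "odd a = odd b" "bin (a div 2) = bin (b div 2)"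
      using less.prems bin_pos[of a] bin_pos[of b] by auto
    moreover from this have "a div 2 = b div 2" using less.IH[of "a div 2"] False by auto
    ultimately show ?thesis by (metis dvd_div_mult_self odd_two_times_div_two_succ mult.commute)
  qed
qed

text \<open>A linear bound is enough, since only polynomially bounded indices get encoded.\<close>

lemma length_bin: "length (bin n) \<le> n"
proof (induction n rule: less_induct)
  case (less n)
  show ?case
  proof (cases "n = 0")
    case False
    then have "length (bin (n div 2)) \<le> n div 2" using less by auto
    then show ?thesis using False bin_pos[of n] by auto
  qed simp
qed

lemma sd_Nil [simp]: "sd [] = [False, True]"
  by (simp add: sd_def)

lemma sd_Cons [simp]: "sd (x # xs) = x # x # sd xs"
  by (simp add: sd_def)

lemma length_sd [simp]: "length (sd xs) = 2 * length xs + 2"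
  by (induction xs) auto

text \<open>A doubled bit never equals the terminator \<open>[False, True]\<close>, so the code is
  prefix-free.\<close>

lemma sd_append_inj: "sd xs @ u = sd ys @ v \<longleftrightarrow> xs = ys \<and> u = v"
proof (induction xs arbitrary: ys)
  case Nil
  show ?case by (cases ys) auto
next
  case (Cons x xs)
  show ?case by (cases ys) (auto simp: Cons)
qed

lemma enc_nat_append_inj [simp]: "enc_nat a @ u = enc_nat b @ v \<longleftrightarrow> a = b \<and> u = v"
  by (auto simp: enc_nat_def sd_append_inj dest: bin_inj)

lemma length_enc_nat: "length (enc_nat a) \<le> 2 * a + 2"
  using length_bin[of a] by (simp add: enc_nat_def)

lemma enc_gate_append_inj: "enc_gate g @ u = enc_gate h @ v \<Longrightarrow> g = h \<and> u = v"
  by (cases g; cases h) (auto split: if_splits)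

lemma concat_enc_gate_inj:
  "length gs = length hs \<Longrightarrow> concat (map enc_gate gs) @ u = concat (map enc_gate hs) @ v \<Longrightarrow> gs = hs \<and> u = v"
proof (induction gs hs rule: list_induct2)
  case (Cons g gs h hs)
  then show ?case by (auto dest: enc_gate_append_inj)
qed simp

lemma concat_enc_nat_inj:
  "length gs = length hs \<Longrightarrow> concat (map enc_nat gs) = concat (map enc_nat hs) \<Longrightarrow> gs = hs"
  by (induction gs hs rule: list_induct2) auto

text \<open>Each list is preceded by its length and each item is prefix-free, so parsing is forced.
  This ties the existential circuit in \<open>avoid_rel\<close> to the encoded one.\<close>

lemma enc_circ_inj:
  assumes "enc_circ C = enc_circ D"
  shows "C = D"
proof -
  obtain n gs os where C: "C = \<lparr>ninp = n, gates = gs, outs = os\<rparr>" by (cases C)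
  obtain n' gs' os' where D: "D = \<lparr>ninp = n', gates = gs', outs = os'\<rparr>" by (cases D)
  have *: "n = n'" "length gs = length gs'"
    "concat (map enc_gate gs) @ enc_nat (length os) @ concat (map enc_nat os) =
     concat (map enc_gate gs') @ enc_nat (length os') @ concat (map enc_nat os')"
    using assms by (auto simp: C D enc_circ_def)
  from concat_enc_gate_inj[OF *(2,3)]
  have "gs = gs'" "length os = length os'" "concat (map enc_nat os) = concat (map enc_nat os')" by auto
  then show ?thesis using *(1) concat_enc_nat_inj by (auto simp: C D)
qed

text \<open>Seed bits become negations of the wires 2 (true) and 3 (false) of a constant prefix, because
  \<open>enc_nat 2\<close> and \<open>enc_nat 3\<close> have equal length, unlike the encodings of the two constant gates.\<close>
fun hw_gate :: "nat \<Rightarrow> bool list \<Rightarrow> gate \<Rightarrow> gate" where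
  "hw_gate n s (GIn i) = (if i < n then GIn i else GNot (if lk s (i - n) then 3 else 2))"
| "hw_gate n s (GConst b) = GConst b"
| "hw_gate n s (GNot i) = GNot (i + 4)"
| "hw_gate n s (GAnd i j) = GAnd (i + 4) (j + 4)"
| "hw_gate n s (GOr i j) = GOr (i + 4) (j + 4)"

text \<open>Wires 0 and 1 are padding that moves the two constants to the indices 2 and 3.\<close>

definition hw_prefix :: "gate list" where
  "hw_prefix = [GConst False, GConst False, GConst True, GConst False]"

definition hardwire :: "nat \<Rightarrow> gate list \<Rightarrow> nat list \<Rightarrow> bool list \<Rightarrow> circuit" where
  "hardwire n gs os s = \<lparr>ninp = n, gates = hw_prefix @ map (hw_gate n s) gs, outs = map (\<lambda>i. i + 4) os\<rparr>"

lemma wires_hw_prefix: "wires x hw_prefix = [False, False, True, False]"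
  by (simp add: wires_def hw_prefix_def)

lemma wires_hardwire:
  assumes "length x = n"
  shows "wires x (hw_prefix @ map (hw_gate n s) gs) = [False, False, True, False] @ wires (x @ s) gs"
proof (induction gs rule: rev_induct)
  case Nil
  show ?case by (simp add: wires_hw_prefix)
next
  case (snoc g gs)
  let ?p = "[False, False, True, False]"
  \<comment> \<open>This also holds for \<open>i\<close> past the end, so references to later wires
    still read as \<open>False\<close> after the shift.\<close>
  have lk: "lk (?p @ vs) (i + 4) = lk vs i" for vs i
    using lk_append[of ?p vs "i + 4"] by simp
  have lk23: "lk (?p @ vs) 2" "\<not> lk (?p @ vs) 3" for vs by (simp_all add: lk_append nth_Cons')
  have "gate_val x (?p @ wires (x @ s) gs) (hw_gate n s g) = gate_val (x @ s) (wires (x @ s) gs) g"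
    by (cases g) (simp_all only: hw_gate.simps gate_val.simps lk, auto simp: lk_append assms lk23[simplified])
  then show ?case using snoc by (simp del: append_Cons append_assoc add: append_assoc[symmetric])
qed

lemma circ_eval_hardwire:
  "length x = n \<Longrightarrow> circ_eval (hardwire n gs os s) x = map (lk (wires (x @ s) gs)) os"
  unfolding circ_eval_def hardwire_def by (simp add: wires_hardwire lk_append del: append_Cons)

lemma circ_size_hardwire: "circ_size (hardwire n gs os s) = n + (4 + length gs) + length os"
  by (simp add: circ_size_def hardwire_def hw_prefix_def)

section \<open>Dependence of the encoding on the seed\<close>

definition projection :: "bfun \<Rightarrow> bool" where
  "projection f \<longleftrightarrow> (\<exists>b. f = (\<lambda>s. b)) \<or> (\<exists>i. f = (\<lambda>s. lk s i))"

text \<open>The list \<open>ts\<close> is fixed before the seed, so the length is constant and each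
  position is a constant or one fixed seed bit. A circuit holding the seed as input therefore gets
  the encoding without further gates.\<close>

definition template :: "(bool list \<Rightarrow> bool list) \<Rightarrow> bool" where
  "template F \<longleftrightarrow> (\<exists>ts. (\<forall>t\<in>set ts. projection t) \<and> (\<forall>s. F s = map (\<lambda>t. t s) ts))"

lemma template_const: "template (\<lambda>s. w)"
  unfolding template_def
  by (intro exI[of _ "map (\<lambda>b s. b) w"]) (auto simp: projection_def o_def)

lemma template_append:
  assumes "template F" "template H"
  shows "template (\<lambda>s. F s @ H s)"
proof -
  obtain ts where "\<forall>t\<in>set ts. projection t" "\<forall>s. F s = map (\<lambda>t. t s) ts"
    using assms(1) unfolding template_def by blast
  moreover obtain us where "\<forall>t\<in>set us. projection t" "\<forall>s. H s = map (\<lambda>t. t s) us"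
    using assms(2) unfolding template_def by blast
  ultimately show ?thesis unfolding template_def by (intro exI[of _ "ts @ us"]) auto
qed

lemma template_concat:
  assumes "\<And>x. x \<in> set xs \<Longrightarrow> template (F x)"
  shows "template (\<lambda>s. concat (map (\<lambda>x. F x s) xs))"
  using assms
proof (induction xs)
  case Nil
  show ?case using template_const[of "[]"] by simp
next
  case (Cons x xs)
  then have "template (\<lambda>s. F x s @ concat (map (\<lambda>x. F x s) xs))" by (intro template_append) auto
  then show ?case by simp
qed

lemma template_enc_gate: "template (\<lambda>s. enc_gate (hw_gate n s g))"
proof (cases g)
  case (GIn i)
  show ?thesis
  proof (cases "i < n")
    case True
    then show ?thesis using template_const by (simp add: GIn)
  next
    case False
    let ?b = "\<lambda>s. lk s (i - n)"
    have "bin 2 = [False, True]" "bin 3 = [True, True]"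
      by (simp_all add: bin_pos)
    \<comment> \<open>The numbers 2 and 3 differ only in the lowest bit, which \<open>bin\<close>
      puts first and \<open>sd\<close> doubles.\<close>
    then have "enc_nat (if b then 3 else 2) = [b, b, True, True, False, True]" for b
      by (simp add: enc_nat_def)
    then have "(\<lambda>s. enc_gate (hw_gate n s g)) = (\<lambda>s. enc_nat 2 @ [?b s, ?b s, True, True, False, True])"
      using False by (simp add: GIn fun_eq_iff)
    moreover have "template (\<lambda>s. [?b s, ?b s, True, True, False, True])"
      unfolding template_def
      by (intro exI[of _ "[?b, ?b, \<lambda>s. True, \<lambda>s. True, \<lambda>s. False, \<lambda>s. True]"])
        (auto simp: projection_def)
    ultimately show ?thesis using template_append[OF template_const] by simp
  qed
qed (use template_const in simp_all)

lemma template_enc_hardwire: "template (\<lambda>s. enc_circ (hardwire n gs os s))"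
proof -
  have "template (\<lambda>s. concat (map (\<lambda>g. enc_gate (hw_gate n s g)) gs))"
    by (rule template_concat) (rule template_enc_gate)
  then have "template (\<lambda>s. (enc_nat n @ enc_nat (4 + length gs) @ concat (map enc_gate hw_prefix)) @
     (\<lambda>s. concat (map (\<lambda>g. enc_gate (hw_gate n s g)) gs)) s @
     (enc_nat (length os) @ concat (map enc_nat (map (\<lambda>i. i + 4) os))))"
    by (intro template_append template_const)
  moreover have "enc_circ (hardwire n gs os s) = (enc_nat n @ enc_nat (4 + length gs) @ concat (map enc_gate hw_prefix)) @
     (\<lambda>s. concat (map (\<lambda>g. enc_gate (hw_gate n s g)) gs)) s @
     (enc_nat (length os) @ concat (map enc_nat (map (\<lambda>i. i + 4) os)))" for s
    by (simp add: enc_circ_def hardwire_def hw_prefix_def o_def numeral_eq_Suc)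
  ultimately show ?thesis by simp
qed

lemma length_concat_le: "(\<And>x. x \<in> set xs \<Longrightarrow> length (f x) \<le> b) \<Longrightarrow> length (concat (map f xs)) \<le> length xs * b"
  by (induction xs) (auto simp: add_mono)

text \<open>The worst case is a binary gate: at most 10 bits for the tag and
  \<open>2 * gate_idx g + 2\<close> for each index.\<close>

lemma length_enc_gate: "length (enc_gate g) \<le> 4 * gate_idx g + 14"
proof (cases g)
  case (GIn i)
  then show ?thesis using length_enc_nat[of 0] length_enc_nat[of i] by simp
next
  case (GConst b)
  then show ?thesis using length_enc_nat[of 0] length_enc_nat[of 1] by auto
next
  case (GNot i)
  then show ?thesis using length_enc_nat[of 2] length_enc_nat[of i] by simp
next
  case (GAnd i j)
  then show ?thesis using length_enc_nat[of 3] length_enc_nat[of i] length_enc_nat[of j] by simp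
next
  case (GOr i j)
  then show ?thesis using length_enc_nat[of 4] length_enc_nat[of i] length_enc_nat[of j] by simp
qed

lemma length_enc_hardwire:
  assumes "\<forall>g\<in>set gs. gate_idx g < n + d + length gs" "\<forall>i\<in>set os. i < length gs"
  shows "length (enc_circ (hardwire n gs os s)) \<le>
    2 * n + 2 + (2 * (4 + length gs) + 2) + (4 + length gs) * (4 * (n + d + length gs + 4) + 14) +
    (2 * length os + 2) + length os * (2 * (length gs + 4) + 2)"
proof -
  have 3: "ninp (hardwire n gs os s) = n" "length (gates (hardwire n gs os s)) = 4 + length gs"
     "length (outs (hardwire n gs os s)) = length os"
    by (simp_all add: hardwire_def hw_prefix_def)
  have "gate_idx (hw_gate n s g) \<le> n + d + length gs + 4" if "g \<in> set gs" for g
  proof -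
    have "gate_idx g < n + d + length gs" using assms(1) that by blast
    then show ?thesis by (cases g) auto
  qed
  then have "gate_idx g \<le> n + d + length gs + 4" if "g \<in> set (gates (hardwire n gs os s))" for g
    using that by (auto simp: hardwire_def hw_prefix_def)
  then have "length (enc_gate g) \<le> 4 * (n + d + length gs + 4) + 14" if "g \<in> set (gates (hardwire n gs os s))" for g
    using that length_enc_gate[of g] by (meson add_le_mono1 le_trans mult_le_mono2)
  from length_concat_le[of "gates (hardwire n gs os s)" enc_gate, OF this]
  have 1: "length (concat (map enc_gate (gates (hardwire n gs os s)))) \<le>
      (4 + length gs) * (4 * (n + d + length gs + 4) + 14)"
    by (simp only: 3)
  have "length (enc_nat i) \<le> 2 * (length gs + 4) + 2" if "i \<in> set (outs (hardwire n gs os s))" for i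
  proof -
    have "i \<le> length gs + 4" using that assms(2) by (fastforce simp: hardwire_def)
    then show ?thesis using length_enc_nat[of i] by simp
  qed
  from length_concat_le[of "outs (hardwire n gs os s)" enc_nat, OF this]
  have 2: "length (concat (map enc_nat (outs (hardwire n gs os s)))) \<le> length os * (2 * (length gs + 4) + 2)"
    by (simp only: 3)
  show ?thesis
    unfolding enc_circ_def 3 length_append
    using 1 2 length_enc_nat[of n] length_enc_nat[of "4 + length gs"] length_enc_nat[of "length os"]
    by linarith
qed

section \<open>Extractors\<close>

lemma finite_bits: "finite {x :: bool list. length x = k}"
  using finite_lists_length_eq[of "UNIV :: bool set" k] by simp

lemma card_bits: "card {x :: bool list. length x = k} = 2 ^ k"
  using card_lists_length_eq[of "UNIV :: bool set" k] by simp

lemma bits_nonempty: "{x :: bool list. length x = k} \<noteq> {}"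
  by (auto intro: exI[of _ "replicate k True"])

lemma pair_pmf_of_set:
  fixes A :: "'a set" and B :: "'b set"
  assumes "finite A" "A \<noteq> {}" "finite B" "B \<noteq> {}"
  shows "pair_pmf (pmf_of_set A) (pmf_of_set B) = pmf_of_set (A \<times> B)"
proof (rule pmf_eqI)
  fix z :: "'a \<times> 'b"
  obtain a b where z: "z = (a, b)" by fastforce
  show "pmf (pair_pmf (pmf_of_set A) (pmf_of_set B)) z = pmf (pmf_of_set (A \<times> B)) z"
    using assms by (simp add: z pmf_pair card_cartesian_product indicator_def)
qed

lemma extractor_missed_card:
  fixes E :: "bool list \<Rightarrow> bool list \<Rightarrow> bool list" and N d m :: nat
  assumes ext: "\<And>X. is_k_source (real N - 1) N X \<Longrightarrow>
        stat_dist (map_pmf (\<lambda>(x, s). (s, E x s)) (pair_pmf X (uniform_bits d)))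
                  (pair_pmf (uniform_bits d) (uniform_bits m)) \<le> (1/2) ^ (m + 1)"
    and y: "\<And>s. length s = d \<Longrightarrow> length (y s) = m"
  shows "real (card {z. length z = N \<and> (\<forall>s. length s = d \<longrightarrow> E z s \<noteq> y s)}) < 2 ^ N / 2"
proof (rule ccontr)
  let ?Z = "{z. length z = N \<and> (\<forall>s. length s = d \<longrightarrow> E z s \<noteq> y s)}"
  let ?D = "{s :: bool list. length s = d}"
  let ?M = "{s :: bool list. length s = m}"
  assume "\<not> real (card ?Z) < 2 ^ N / 2"
  then have card: "real (card ?Z) \<ge> 2 ^ N / 2" by simp
  have pos: "real (card ?Z) > 0" by (rule less_le_trans[OF _ card]) simp
  then have "?Z \<noteq> {}" by (metis card.empty less_irrefl of_nat_0)
  have fin: "finite ?Z" by (rule finite_subset[OF _ finite_bits[of N]]) auto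
  let ?X = "pmf_of_set ?Z"
  have "is_k_source (real N - 1) N ?X"
    unfolding is_k_source_def
  proof (intro conjI allI)
    show "set_pmf ?X \<subseteq> {x. length x = N}" using fin \<open>?Z \<noteq> {}\<close> by auto
    fix x
    have "pmf ?X x \<le> 1 / real (card ?Z)" using fin \<open>?Z \<noteq> {}\<close> by (simp add: indicator_def)
    also have "\<dots> \<le> 1 / (2 ^ N / 2)" using card pos by (intro divide_left_mono mult_pos_pos) auto
    also have "\<dots> = 2 powr (- (real N - 1))" by (simp add: powr_diff powr_realpow)
    finally show "pmf ?X x \<le> 2 powr (- (real N - 1))" .
  qed
  let ?P = "map_pmf (\<lambda>(x, s). (s, E x s)) (pair_pmf ?X (uniform_bits d))"
  let ?Q = "pair_pmf (uniform_bits d) (uniform_bits m)"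
  have sd: "stat_dist ?P ?Q \<le> (1/2) ^ (m + 1)" by (rule ext) fact
  \<comment> \<open>The distinguishing event is the graph of \<open>y\<close> over all
    seeds.\<close>
  let ?Ev = "(\<lambda>s. (s, y s)) ` ?D"
  have disj: "?Ev \<inter> set_pmf ?P = {}"
    using fin \<open>?Z \<noteq> {}\<close> finite_bits bits_nonempty by (auto simp: uniform_bits_def)
  have P: "measure_pmf.prob ?P ?Ev = 0"
    using measure_Int_set_pmf[of ?P ?Ev] unfolding disj measure_empty by (rule sym)
  have "?Q = pmf_of_set (?D \<times> ?M)"
    unfolding uniform_bits_def
    by (rule pair_pmf_of_set) (use finite_bits bits_nonempty in auto)
  then have "measure_pmf.prob ?Q ?Ev = real (card ((?D \<times> ?M) \<inter> ?Ev)) / real (card (?D \<times> ?M))"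
    using finite_bits[of d] finite_bits[of m] bits_nonempty[of d] bits_nonempty[of m]
    by (simp add: measure_pmf_of_set)
  also have "(?D \<times> ?M) \<inter> ?Ev = ?Ev" using y by auto
  also have "card ?Ev = 2 ^ d" by (subst card_image) (auto simp: inj_on_def card_bits)
  finally have Q: "measure_pmf.prob ?Q ?Ev = (1/2) ^ m"
    by (simp add: card_cartesian_product card_bits power_one_over)
  have "\<bar>measure_pmf.prob ?P ?Ev - measure_pmf.prob ?Q ?Ev\<bar> \<le> stat_dist ?P ?Q"
    unfolding stat_dist_def
  proof (rule cSUP_upper)
    \<comment> \<open>\<open>stat_dist\<close> is a supremum of reals, so a single event bounds it
      from below only once the range is known to be bounded.\<close>
    show "bdd_above (range (\<lambda>E. \<bar>measure_pmf.prob ?P E - measure_pmf.prob ?Q E\<bar>))"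
    proof (rule bdd_aboveI)
      fix r assume "r \<in> range (\<lambda>E. \<bar>measure_pmf.prob ?P E - measure_pmf.prob ?Q E\<bar>)"
      then obtain E' where "r = \<bar>measure_pmf.prob ?P E' - measure_pmf.prob ?Q E'\<bar>" by blast
      then show "r \<le> 1"
        using measure_pmf.prob_le_1[of ?P E'] measure_pmf.prob_le_1[of ?Q E']
          measure_nonneg[of "measure_pmf ?P" E'] measure_nonneg[of "measure_pmf ?Q" E'] by linarith
    qed
  qed simp
  then have "(1/2 :: real) ^ m \<le> (1/2) ^ (m + 1)" using sd unfolding P Q by linarith
  then show False by simp
qed

text \<open>If \<open>m\<close> exceeded \<open>N\<close>, each seed would have some
  \<open>y s\<close> outside the image of \<open>E\<close>, by counting; then every \<open>z\<close>
  would miss, contradicting the previous bound. This makes \<open>m\<close> polynomial in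
  \<open>n\<close>.\<close>

lemma extractor_output_le:
  fixes E :: "bool list \<Rightarrow> bool list \<Rightarrow> bool list" and N d m :: nat
  assumes ext: "\<And>X. is_k_source (real N - 1) N X \<Longrightarrow>
        stat_dist (map_pmf (\<lambda>(x, s). (s, E x s)) (pair_pmf X (uniform_bits d)))
                  (pair_pmf (uniform_bits d) (uniform_bits m)) \<le> (1/2) ^ (m + 1)"
  shows "m \<le> N"
proof (rule ccontr)
  assume "\<not> m \<le> N"
  have "\<exists>y. length y = m \<and> y \<notin> (\<lambda>z. E z s) ` {z. length z = N}" for s
  proof (rule ccontr)
    assume "\<not> ?thesis"
    then have "{y. length y = m} \<subseteq> (\<lambda>z. E z s) ` {z. length z = N}" by blast
    from surj_card_le[OF finite_bits this] have "(2::nat) ^ m \<le> 2 ^ N" by (simp add: card_bits)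
    then show False using \<open>\<not> m \<le> N\<close> by simp
  qed
  then obtain y where y: "\<And>s. length (y s) = m" "\<And>s. y s \<notin> (\<lambda>z. E z s) ` {z. length z = N}" by metis
  have "E z s \<noteq> y s" if "length z = N" for z s using y(2)[of s] that by (metis (mono_tags) imageI mem_Collect_eq)
  then have "{z. length z = N \<and> (\<forall>s. length s = d \<longrightarrow> E z s \<noteq> y s)} = {z. length z = N}"
    by auto
  then have "(2::real) ^ N < 2 ^ N / 2"
    using extractor_missed_card[where E = E and y = y and N = N, OF ext y(1)] by (simp add: card_bits)
  moreover have "(2::real) ^ N > 0" by simp
  ultimately show False by linarith
qed

text \<open>The extractor machine is unrolled on a word assembled from available wires and
  constants, so preparing its input takes no gates.\<close>

lemma ckt_extractor:
  assumes ext: "strong_extractor N d m Ext k eps"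
    and poly: "poly_bounded N (\<lambda>n. n)" "poly_bounded d (\<lambda>n. n)" "poly_bounded m (\<lambda>n. n)"
  shows "\<exists>p. poly_bounded p (\<lambda>n. n) \<and> (\<forall>n k A s Z T. ckt k A s \<longrightarrow> (\<lambda>x. True) \<in> A \<longrightarrow> (\<lambda>x. False) \<in> A \<longrightarrow>
    (\<forall>i<N n. Z i \<in> A) \<longrightarrow> (\<forall>i<d n. T i \<in> A) \<longrightarrow>
    ckt k (A \<union> (\<lambda>j x. Ext n (map (\<lambda>i. Z i x) [0..<N n]) (map (\<lambda>i. T i x) [0..<d n]) ! j) ` {..<m n}) (s + p n))"
proof -
  obtain M where M: "ntm_wf M" "deterministic M" "poly_time M"
    and acc: "\<And>n X s y. length X = N n \<Longrightarrow> length s = d n \<Longrightarrow>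
           accepts_with M (sd (replicate n True) @ sd X @ s) y \<longleftrightarrow> y = Ext n X s"
    using ext unfolding strong_extractor_def by blast
  have len: "\<And>n X s. length X = N n \<Longrightarrow> length s = d n \<Longrightarrow> length (Ext n X s) = m n"
    using ext unfolding strong_extractor_def by blast
  obtain c K S where *: "\<forall>k A s L W m f. ckt k A s \<longrightarrow> (\<lambda>x. True) \<in> A \<longrightarrow> (\<forall>i<L. W i \<in> A) \<longrightarrow>
    (\<forall>x. length (f x) = m \<and> accepts_with M (map (\<lambda>i. W i x) [0..<L]) (f x)) \<longrightarrow>
    ckt k (A \<union> (\<lambda>j x. f x ! j) ` {..<m}) (s + sim_cost c K S L m)"
    using ckt_deterministic[OF M] by (elim exE)
  define L where "L = (\<lambda>n. (2 * n + 2) + (2 * N n + 2) + d n)"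
  define p where "p = (\<lambda>n. sim_cost c K S (L n) (m n))"
  have "poly_bounded L (\<lambda>n. n)" unfolding L_def by (intro poly_bounded_intros poly)
  then have "poly_bounded p (\<lambda>n. n)" unfolding p_def by (intro poly_bounded_sim_cost poly)
  moreover have "ckt k (A \<union> (\<lambda>j x. Ext n (map (\<lambda>i. Z i x) [0..<N n]) (map (\<lambda>i. T i x) [0..<d n]) ! j) ` {..<m n}) (s + p n)"
    if ckt: "ckt k A s" and A: "(\<lambda>x. True) \<in> A" "(\<lambda>x. False) \<in> A" "\<forall>i<N n. Z i \<in> A" "\<forall>i<d n. T i \<in> A"
    for n k A s Z T
  proof -
    \<comment> \<open>The word \<open>sd (replicate n True) @ sd X @ s\<close> as a list of
      functions; doubling a bit just lists its wire twice.\<close>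
    define Ws where "Ws = map (\<lambda>b x. b) (sd (replicate n True)) @
      concat (map (\<lambda>i. [Z i, Z i]) [0..<N n]) @ [\<lambda>x. False, \<lambda>x. True] @ map T [0..<d n]"
    have b: "(\<lambda>x. b) \<in> A" for b using A(1,2) by (cases b) auto
    then have "set Ws \<subseteq> A" using A(3,4) unfolding Ws_def by auto
    moreover have lenWs: "length Ws = L n"
      by (simp add: Ws_def L_def length_concat o_def sum_list_triv)
    ultimately have W: "\<forall>i<L n. Ws ! i \<in> A" by (metis nth_mem subsetD)
    have "map (\<lambda>i. (Ws ! i) x) [0..<L n] = map (\<lambda>w. w x) Ws" for x
      using lenWs by (intro nth_equalityI) auto
    also have "map (\<lambda>w. w x) Ws = sd (replicate n True) @ sd (map (\<lambda>i. Z i x) [0..<N n]) @ map (\<lambda>i. T i x) [0..<d n]" for x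
      by (simp add: Ws_def sd_def map_concat o_def)
    finally have "\<forall>x. length (Ext n (map (\<lambda>i. Z i x) [0..<N n]) (map (\<lambda>i. T i x) [0..<d n])) = m n \<and>
       accepts_with M (map (\<lambda>i. (Ws ! i) x) [0..<L n]) (Ext n (map (\<lambda>i. Z i x) [0..<N n]) (map (\<lambda>i. T i x) [0..<d n]))"
      using acc len by simp
    from *[rule_format, OF ckt A(1) W[rule_format] this[rule_format]] show ?thesis unfolding p_def by simp
  qed
  ultimately show ?thesis by (intro exI[of _ p] conjI allI impI)
qed

lemma ckt_outputs:
  assumes "ckt n A s" "\<And>j. j < m \<Longrightarrow> F j \<in> A"
  shows "\<exists>gs os. length gs \<le> s \<and> (\<forall>g\<in>set gs. gate_idx g < n + length gs) \<and> length os = m \<and>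
    (\<forall>i\<in>set os. i < length gs) \<and> (\<forall>x. map (lk (wires x gs)) os = map (\<lambda>j. F j x) [0..<m])"
proof -
  obtain gs where gs: "length gs \<le> s" "\<forall>g\<in>set gs. gate_idx g < n + length gs"
    "\<forall>f\<in>A. \<exists>i<length gs. \<forall>x. wires x gs ! i = f x"
    using assms(1) unfolding ckt_def by blast
  have "\<exists>i<length gs. \<forall>x. wires x gs ! i = F j x" if "j < m" for j using gs(3) assms(2)[OF that] by blast
  then obtain o' where o: "\<And>j. j < m \<Longrightarrow> o' j < length gs" "\<And>j x. j < m \<Longrightarrow> wires x gs ! o' j = F j x"
    by metis
  show ?thesis
    by (rule exI[of _ gs], rule exI[of _ "map o' [0..<m]"]) (use gs(1,2) o in auto)
qed

text \<open>One circuit for \<open>Ext n (G n x) s\<close> with inputs \<open>x\<close> followed by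
  \<open>s\<close>, the layout in which \<open>hardwire\<close> replaces the inputs from
  \<open>n\<close> on.\<close>

lemma ckt_extractor_generator:
  fixes G :: "nat \<Rightarrow> bool list \<Rightarrow> bool list"
  assumes ext: "strong_extractor N d m Ext k eps"
    and poly: "poly_bounded N (\<lambda>n. n)" "poly_bounded d (\<lambda>n. n)" "poly_bounded m (\<lambda>n. n)"
    and G: "\<And>n x. length x = n \<Longrightarrow> length (G n x) = N n"
    and CG: "poly_bounded (\<lambda>n. circ_size (CG n)) (\<lambda>n. n)"
      "\<And>n x. length x = n \<Longrightarrow> circ_eval (CG n) x = G n x"
  shows "\<exists>p es os. poly_bounded p (\<lambda>n. n) \<and> (\<forall>n. length (es n) \<le> p n \<and>
     (\<forall>g\<in>set (es n). gate_idx g < n + d n + length (es n)) \<and> length (os n) = m n \<and>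
     (\<forall>i\<in>set (os n). i < length (es n)) \<and>
     (\<forall>x s. length x = n \<longrightarrow> length s = d n \<longrightarrow> map (lk (wires (x @ s) (es n))) (os n) = Ext n (G n x) s))"
proof -
  obtain q where q: "poly_bounded q (\<lambda>n. n)" and
    *: "\<forall>n k A s Z T. ckt k A s \<longrightarrow> (\<lambda>x. True) \<in> A \<longrightarrow> (\<lambda>x. False) \<in> A \<longrightarrow>
    (\<forall>i<N n. Z i \<in> A) \<longrightarrow> (\<forall>i<d n. T i \<in> A) \<longrightarrow>
    ckt k (A \<union> (\<lambda>j x. Ext n (map (\<lambda>i. Z i x) [0..<N n]) (map (\<lambda>i. T i x) [0..<d n]) ! j) ` {..<m n}) (s + q n)"
    using ckt_extractor[OF ext poly] by (elim exE conjE)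
  have len: "\<And>n X s. length X = N n \<Longrightarrow> length s = d n \<Longrightarrow> length (Ext n X s) = m n"
    using ext unfolding strong_extractor_def by blast
  define p where "p = (\<lambda>n. n + d n + 2 + circ_size (CG n) + q n)"
  have p: "poly_bounded p (\<lambda>n. n)" unfolding p_def by (intro poly_bounded_intros poly CG q)
  have "\<exists>es os. length es \<le> p n \<and>
     (\<forall>g\<in>set es. gate_idx g < n + d n + length es) \<and> length os = m n \<and>
     (\<forall>i\<in>set os. i < length es) \<and>
     (\<forall>x s. length x = n \<longrightarrow> length s = d n \<longrightarrow> map (lk (wires (x @ s) es)) os = Ext n (G n x) s)" for n
  proof -
    let ?A = "{\<lambda>x. True, \<lambda>x. False} \<union> (\<lambda>i x. lk x i) ` {..<n + d n}"
    let ?gs = "gates (CG n)"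
    let ?x = "\<lambda>u. map (\<lambda>i. lk u i) [0..<n]"
    let ?B = "?A \<union> (\<lambda>j u. lk (wires (?x u) ?gs) j) ` UNIV"
    \<comment> \<open>The gates of \<open>CG n\<close> may carry arbitrarily large indices;
      rebuilding them by composition replaces dangling references by \<open>False\<close> and
      restores the index bound.\<close>
    have 1: "ckt (n + d n) ?B (n + d n + 2 + length ?gs)"
      by (rule ckt_compose[OF ckt_inputs]) auto
    let ?Z = "\<lambda>i u. lk (wires (?x u) ?gs) (outs (CG n) ! i)"
    let ?T = "\<lambda>i u. lk u (n + i)"
    let ?F = "\<lambda>j u. Ext n (map (\<lambda>i. ?Z i u) [0..<N n]) (map (\<lambda>i. ?T i u) [0..<d n]) ! j"
    have 2: "ckt (n + d n) (?B \<union> ?F ` {..<m n}) (n + d n + 2 + length ?gs + q n)"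
      by (rule *[rule_format, OF 1]) auto
    have 3: "ckt (n + d n) (?B \<union> ?F ` {..<m n}) (p n)"
      by (rule ckt_mono[OF 2]) (auto simp: p_def circ_size_def)
    obtain es os where es: "length es \<le> p n" "\<forall>g\<in>set es. gate_idx g < n + d n + length es"
      "length os = m n" "\<forall>i\<in>set os. i < length es"
      "\<forall>x. map (lk (wires x es)) os = map (\<lambda>j. ?F j x) [0..<m n]"
      using ckt_outputs[OF 3, of "m n" ?F] by auto
    have "map (lk (wires (x @ s) es)) os = Ext n (G n x) s" if x: "length x = n" and s: "length s = d n" for x s
    proof -
      have x': "?x (x @ s) = x" using x by (intro nth_equalityI) (auto simp: lk_append)
      have s': "map (\<lambda>i. ?T i (x @ s)) [0..<d n] = s" using x s by (intro nth_equalityI) (auto simp: lk_append)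
      have "circ_eval (CG n) x = G n x" using CG(2) x .
      then have ev: "map (lk (wires x ?gs)) (outs (CG n)) = G n x" by (simp add: circ_eval_def)
      then have "length (outs (CG n)) = N n" using G[OF x] by (metis length_map)
      then have z': "map (\<lambda>i. ?Z i (x @ s)) [0..<N n] = G n x"
        unfolding x' ev[symmetric] by (intro nth_equalityI) auto
      have "map (lk (wires (x @ s) es)) os = map (\<lambda>j. Ext n (G n x) s ! j) [0..<m n]"
        using es(5)[rule_format, of "x @ s"] unfolding z' s' .
      also have "\<dots> = Ext n (G n x) s" using len[OF G[OF x] s] by (metis map_nth)
      finally show ?thesis .
    qed
    then show ?thesis using es(1-4) by blast
  qed
  then obtain es os where "\<And>n. length (es n) \<le> p n \<and>
     (\<forall>g\<in>set (es n). gate_idx g < n + d n + length (es n)) \<and> length (os n) = m n \<and>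
     (\<forall>i\<in>set (os n). i < length (es n)) \<and>
     (\<forall>x s. length x = n \<longrightarrow> length s = d n \<longrightarrow> map (lk (wires (x @ s) (es n))) (os n) = Ext n (G n x) s)"
    by metis
  then show ?thesis using p by blast
qed

section \<open>The reduction\<close>

text \<open>Pigeonhole: there are more output strings than inputs.\<close>

lemma avoid_rel_solvable:
  assumes "length (outs C) > ninp C"
  shows "\<exists>y. avoid_rel (enc_circ C) y"
proof (rule ccontr)
  assume "\<not> ?thesis"
  then have "{y. length y = length (outs C)} \<subseteq> circ_eval C ` {x. length x = ninp C}"
    unfolding avoid_rel_def by blast
  from surj_card_le[OF finite_bits this] have "(2::nat) ^ length (outs C) \<le> 2 ^ ninp C" by (simp add: card_bits)
  then show False using assms by simp
qed

lemma avoid_relD: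
  assumes "avoid_rel (enc_circ C) y"
  shows "length y = length (outs C)" "y \<notin> circ_eval C ` {x. length x = ninp C}"
  using assms enc_circ_inj unfolding avoid_rel_def by blast+

theorem theorem3p1:
  fixes m N d :: "nat \<Rightarrow> nat"
    and G :: "nat \<Rightarrow> bool list \<Rightarrow> bool list"
    and Ext :: "nat \<Rightarrow> bool list \<Rightarrow> bool list \<Rightarrow> bool list"
  assumes "\<forall>n. m n > n"
    and "poly_bounded N m"
    and "poly_bounded d m"
    and "demibits_generator N G"
    and "strong_extractor N d m Ext (\<lambda>n. real (N n) - 1) (\<lambda>n. (1/2) ^ (m n + 1))"
  shows "\<exists>c. \<not> SearchNP (avoid_instances m c) avoid_rel"
proof (rule ccontr)
  assume "\<not> ?thesis"
  \<comment> \<open>A solver exists for every size bound; \<open>c\<close> is picked only once the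
    size of the circuits \<open>C n s\<close> is known.\<close>
  then have search: "SearchNP (avoid_instances m c) avoid_rel" for c by blast
  have G: "\<And>n x. length x = n \<Longrightarrow> length (G n x) = N n"
    and secure: "\<And>D. poly_bounded (\<lambda>n. circ_size (D n)) (\<lambda>n. n) \<Longrightarrow>
          (\<forall>n. N n \<le> ninp (D n) \<and> length (outs (D n)) = 1) \<Longrightarrow>
          (\<exists>n0. \<forall>n\<ge>n0. \<not> (frac_accepted (D n) (N n) \<ge> 1/3 \<and>
                              (\<forall>x. length x = n \<longrightarrow> \<not> ndet_accepts (D n) (N n) (G n x))))"
    using assms(4) unfolding demibits_generator_def by blast+
  obtain CG where CG: "poly_bounded (\<lambda>n. circ_size (CG n)) (\<lambda>n. n)"
      "\<And>n x. length x = n \<Longrightarrow> circ_eval (CG n) x = G n x"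
    using assms(4) unfolding demibits_generator_def by blast
  have ext: "\<And>n X. is_k_source (real (N n) - 1) (N n) X \<Longrightarrow>
        stat_dist (map_pmf (\<lambda>(x, s). (s, Ext n x s)) (pair_pmf X (uniform_bits (d n))))
                  (pair_pmf (uniform_bits (d n)) (uniform_bits (m n))) \<le> (1/2) ^ (m n + 1)"
    and len_Ext: "\<And>n X s. length X = N n \<Longrightarrow> length s = d n \<Longrightarrow> length (Ext n X s) = m n"
    using assms(5) unfolding strong_extractor_def by blast+
  \<comment> \<open>The distinguisher must be polynomial in \<open>n\<close>. A circuit lists its
    outputs, which bounds \<open>N\<close>; then \<open>m \<le> N\<close> bounds \<open>m\<close>,
    and \<open>d\<close> is polynomial in \<open>m\<close>.\<close>
  have "N n \<le> circ_size (CG n)" for n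
    using CG(2)[of "replicate n True" n] G[of "replicate n True" n]
    by (auto simp: circ_eval_def circ_size_def dest: arg_cong[of _ _ length])
  then have poly_N: "poly_bounded N (\<lambda>n. n)" by (rule poly_bounded_mono[OF CG(1)])
  have "m n \<le> N n" for n by (rule extractor_output_le) (rule ext)
  then have poly_m: "poly_bounded m (\<lambda>n. n)" by (rule poly_bounded_mono[OF poly_N])
  have poly_d: "poly_bounded d (\<lambda>n. n)" by (rule poly_bounded_trans[OF assms(3) poly_m])
  obtain p es os where p: "poly_bounded p (\<lambda>n. n)" and es: "\<forall>n. length (es n) \<le> p n \<and>
     (\<forall>g\<in>set (es n). gate_idx g < n + d n + length (es n)) \<and> length (os n) = m n \<and>
     (\<forall>i\<in>set (os n). i < length (es n)) \<and>
     (\<forall>x s. length x = n \<longrightarrow> length s = d n \<longrightarrow> map (lk (wires (x @ s) (es n))) (os n) = Ext n (G n x) s)"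
    using ckt_extractor_generator[OF assms(5) poly_N poly_d poly_m, of G CG] G CG by auto
  obtain q where q: "poly_bounded q (\<lambda>n. n)" and
    q_ckt: "\<forall>n k A s Z T. ckt k A s \<longrightarrow> (\<lambda>x. True) \<in> A \<longrightarrow> (\<lambda>x. False) \<in> A \<longrightarrow>
    (\<forall>i<N n. Z i \<in> A) \<longrightarrow> (\<forall>i<d n. T i \<in> A) \<longrightarrow>
    ckt k (A \<union> (\<lambda>j x. Ext n (map (\<lambda>i. Z i x) [0..<N n]) (map (\<lambda>i. T i x) [0..<d n]) ! j) ` {..<m n}) (s + q n)"
    using ckt_extractor[OF assms(5) poly_N poly_d poly_m] by (elim exE conjE)
  define C where "C = (\<lambda>n. hardwire n (es n) (os n))"
  have C_simps: "ninp (C n s) = n" "length (outs (C n s)) = m n" for n s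
    using es by (simp_all add: C_def hardwire_def)
  have C_eval: "circ_eval (C n s) x = Ext n (G n x) s" if "length x = n" "length s = d n" for n s x
    unfolding C_def using circ_eval_hardwire that es by metis
  \<comment> \<open>Instance sizes are measured in \<open>m\<close>; since \<open>n < m n\<close>, a
    bound in \<open>n\<close> carries over.\<close>
  have "poly_bounded (\<lambda>n. n + (4 + p n) + m n) m"
  proof -
    have "poly_bounded (\<lambda>n. n) m"
      by (rule poly_bounded_mono[OF poly_bounded_self]) (use assms(1) less_imp_le in blast)
    then show ?thesis by (intro poly_bounded_intros poly_bounded_trans[OF p])
  qed
  then obtain c where c: "\<And>n. n + (4 + p n) + m n \<le> c * m n ^ c + c" unfolding poly_bounded_def by blast
  have inst: "enc_circ (C n s) \<in> avoid_instances m c" for n s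
  proof -
    have "circ_size (C n s) \<le> n + (4 + p n) + m n"
      using es by (simp add: C_def circ_size_hardwire)
    then have "circ_size (C n s) \<le> c * m n ^ c + c" using c le_trans by blast
    then show ?thesis unfolding avoid_instances_def using C_simps by blast
  qed
  obtain M where M: "ntm_wf M" "poly_time M"
    and M_search: "\<And>w. w \<in> avoid_instances m c \<Longrightarrow> (\<exists>y. avoid_rel w y) \<Longrightarrow>
      (\<exists>y. accepts_with M w y) \<and> (\<forall>y. accepts_with M w y \<longrightarrow> avoid_rel w y)"
    using search[of c] unfolding SearchNP_def by blast
  have M_C: "\<exists>y. accepts_with M (enc_circ (C n s)) y"
      "accepts_with M (enc_circ (C n s)) y \<Longrightarrow> avoid_rel (enc_circ (C n s)) y" for n s y
    using M_search[OF inst avoid_rel_solvable] C_simps assms(1) by auto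
  have "\<exists>ts. (\<forall>t\<in>set ts. projection t) \<and> (\<forall>s. enc_circ (C n s) = map (\<lambda>t. t s) ts)" for n
    using template_enc_hardwire[of n "es n" "os n"] unfolding template_def C_def .
  then obtain ts where ts: "\<And>n t. t \<in> set (ts n) \<Longrightarrow> projection t"
    "\<And>n s. enc_circ (C n s) = map (\<lambda>t. t s) (ts n)" by metis
  define L where "L = (\<lambda>n. length (ts n))"
  have poly_L: "poly_bounded L (\<lambda>n. n)"
  proof (rule poly_bounded_mono)
    show "L n \<le> 2 * n + 2 + (2 * (4 + p n) + 2) + (4 + p n) * (4 * (n + d n + p n + 4) + 14) +
      (2 * m n + 2) + m n * (2 * (p n + 4) + 2)" for n
    proof -
      \<comment> \<open>The length does not depend on the seed, so the empty list serves as
        one.\<close>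
      have "L n = length (enc_circ (C n []))" by (simp add: ts L_def)
      also have "\<dots> \<le> 2 * n + 2 + (2 * (4 + length (es n)) + 2) +
          (4 + length (es n)) * (4 * (n + d n + length (es n) + 4) + 14) +
          (2 * length (os n) + 2) + length (os n) * (2 * (length (es n) + 4) + 2)"
        unfolding C_def by (rule length_enc_hardwire) (use es in auto)
      also have "\<dots> \<le> 2 * n + 2 + (2 * (4 + p n) + 2) + (4 + p n) * (4 * (n + d n + p n + 4) + 14) +
        (2 * m n + 2) + m n * (2 * (p n + 4) + 2)"
        using es by (intro add_mono mult_mono) auto
      finally show ?thesis .
    qed
    show "poly_bounded (\<lambda>n. 2 * n + 2 + (2 * (4 + p n) + 2) + (4 + p n) * (4 * (n + d n + p n + 4) + 14) +
      (2 * m n + 2) + m n * (2 * (p n + 4) + 2)) (\<lambda>n. n)"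
      by (intro poly_bounded_intros p poly_d poly_m)
  qed
  obtain e K S where nd: "\<forall>k A s L W m Y off. ckt k A s \<longrightarrow> (\<forall>i<L. W i \<in> A) \<longrightarrow> (\<forall>j<m. Y j \<in> A) \<longrightarrow>
    (\<forall>j<rounds e L * K. (\<lambda>x. lk x (off + j)) \<in> A) \<longrightarrow>
    (\<exists>f. ckt k (insert f A) (s + sim_cost e K S L m + (m * 5 + 10)) \<and>
      (\<forall>x. f x \<longrightarrow> accepts_with M (map (\<lambda>i. W i x) [0..<L]) (map (\<lambda>j. Y j x) [0..<m])) \<and>
      (\<forall>u w y. length u = off \<longrightarrow> accepts_with M w y \<longrightarrow>
         (\<forall>e. map (\<lambda>i. W i (u @ e)) [0..<L] = w \<and> map (\<lambda>j. Y j (u @ e)) [0..<m] = y) \<longrightarrow>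
         (\<exists>r. length r = rounds e L * K \<and> f (u @ r))))"
    using ckt_nondeterministic[OF M] by (elim exE)
  \<comment> \<open>The inputs of the distinguisher are the string \<open>z\<close>, then a seed,
    then the choice bits of \<open>M\<close>; the last two groups are the witness.\<close>
  define k where "k = (\<lambda>n. N n + d n + rounds e (L n) * K)"
  define P where "P = (\<lambda>n. k n + 2 + q n + sim_cost e K S (L n) (m n) + (m n * 5 + 10))"
  have poly_k: "poly_bounded k (\<lambda>n. n)"
    unfolding k_def by (intro poly_bounded_intros poly_bounded_rounds poly_N poly_d poly_L)
  have poly_P: "poly_bounded P (\<lambda>n. n)"
    unfolding P_def by (intro poly_bounded_intros poly_bounded_sim_cost poly_k q poly_L poly_m)
  have "\<exists>D. circ_size D \<le> k n + P n + 1 \<and> ninp D = k n \<and> length (outs D) = 1 \<and>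
    (\<forall>z. length z = N n \<longrightarrow> (ndet_accepts D (N n) z \<longleftrightarrow>
       (\<exists>s. length s = d n \<and> accepts_with M (enc_circ (C n s)) (Ext n z s))))" for n
  proof -
    let ?A = "{\<lambda>x. True, \<lambda>x. False} \<union> (\<lambda>i x. lk x i) ` {..<k n}"
    let ?z = "\<lambda>u. map (\<lambda>i. lk u i) [0..<N n]"
    let ?s = "\<lambda>u. map (\<lambda>i. lk u (N n + i)) [0..<d n]"
    let ?Y = "\<lambda>j u. Ext n (?z u) (?s u) ! j"
    let ?B = "?A \<union> ?Y ` {..<m n}"
    let ?W = "\<lambda>i u. (ts n ! i) (?s u)"
    have 1: "ckt (k n) ?B (k n + 2 + q n)"
      by (rule q_ckt[rule_format, OF ckt_inputs]) (auto simp: k_def)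
    \<comment> \<open>Each bit of the encoding is a constant, an input, or a read past the end of
      the seed, which is \<open>False\<close>.\<close>
    have W: "?W i \<in> ?B" if "i < L n" for i
    proof -
      have "projection (ts n ! i)" using that unfolding L_def by (intro ts(1)[of _ n] nth_mem)
      then consider b where "ts n ! i = (\<lambda>s. b)" | j where "ts n ! i = (\<lambda>s. lk s j)"
        unfolding projection_def by blast
      then show ?thesis
      proof cases
        case 1
        then show ?thesis by (cases b) auto
      next
        case 2
        show ?thesis
        proof (cases "j < d n")
          case True
          then have "?W i = (\<lambda>u. lk u (N n + j))" using 2 by simp
          then show ?thesis using True by (auto simp: k_def)
        next
          case False
          then have "?W i = (\<lambda>u. False)" using 2 by (simp add: lk_def)
          then show ?thesis by auto
        qed
      qed
    qed
    have W_eq: "map (\<lambda>i. ?W i u) [0..<L n] = enc_circ (C n (?s u))" for u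
      unfolding ts(2) L_def by (intro nth_equalityI) auto
    have Y_eq: "map (\<lambda>j. ?Y j u) [0..<m n] = Ext n (?z u) (?s u)" for u
    proof -
      have "length (Ext n (?z u) (?s u)) = m n" by (rule len_Ext) auto
      then show ?thesis by (metis map_nth)
    qed
    have choice: "\<forall>j<rounds e (L n) * K. (\<lambda>x. lk x (N n + d n + j)) \<in> ?B"
      by (auto simp: k_def)
    obtain f where f: "ckt (k n) (insert f ?B) (k n + 2 + q n + sim_cost e K S (L n) (m n) + (m n * 5 + 10))"
      and f_sound: "\<And>u. f u \<Longrightarrow> accepts_with M (enc_circ (C n (?s u))) (Ext n (?z u) (?s u))"
      and f_complete: "\<And>u w y. length u = N n + d n \<Longrightarrow> accepts_with M w y \<Longrightarrow>
         (\<forall>r. enc_circ (C n (?s (u @ r))) = w \<and> Ext n (?z (u @ r)) (?s (u @ r)) = y) \<Longrightarrow>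
         (\<exists>r. length r = rounds e (L n) * K \<and> f (u @ r))"
      using nd[rule_format, OF 1, of "L n" ?W "m n" ?Y "N n + d n"] W choice
      unfolding W_eq Y_eq by auto
    obtain gs ds where gs: "length gs \<le> P n" "length ds = 1"
       "\<And>u. map (lk (wires u gs)) ds = map (\<lambda>j. f u) [0..<1]"
      using ckt_outputs[OF f, of 1 "\<lambda>j. f"] unfolding P_def by auto
    define D where "D = \<lparr>ninp = k n, gates = gs, outs = ds\<rparr>"
    have eval: "circ_eval D u = [f u]" for u using gs(3)[of u] by (simp add: D_def circ_eval_def)
    have "ndet_accepts D (N n) z \<longleftrightarrow>
       (\<exists>s. length s = d n \<and> accepts_with M (enc_circ (C n s)) (Ext n z s))" if z: "length z = N n" for z
    proof
      assume "ndet_accepts D (N n) z"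
      then obtain v where "f (z @ v)" unfolding ndet_accepts_def eval by auto
      moreover have "?z (z @ v) = z" using z by (intro nth_equalityI) (auto simp: lk_append)
      ultimately show "\<exists>s. length s = d n \<and> accepts_with M (enc_circ (C n s)) (Ext n z s)"
        using f_sound[of "z @ v"] by (intro exI[of _ "?s (z @ v)"]) simp
    next
      assume "\<exists>s. length s = d n \<and> accepts_with M (enc_circ (C n s)) (Ext n z s)"
      then obtain s where s: "length s = d n" "accepts_with M (enc_circ (C n s)) (Ext n z s)" by blast
      have "?z ((z @ s) @ r) = z" for r using z by (intro nth_equalityI) (auto simp: lk_append)
      moreover have "?s ((z @ s) @ r) = s" for r
        using z s(1) by (intro nth_equalityI) (auto simp: lk_append)
      ultimately obtain r where "length r = rounds e (L n) * K" "f ((z @ s) @ r)"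
        using f_complete[OF _ s(2), of "z @ s"] z s(1) by auto
      then show "ndet_accepts D (N n) z"
        unfolding ndet_accepts_def eval by (intro exI[of _ "s @ r"]) (simp add: D_def k_def s(1))
    qed
    moreover have "circ_size D \<le> k n + P n + 1" "ninp D = k n" "length (outs D) = 1"
      using gs(1,2) by (simp_all add: D_def circ_size_def)
    ultimately show ?thesis by blast
  qed
  then obtain D where D: "\<And>n. circ_size (D n) \<le> k n + P n + 1" "\<And>n. ninp (D n) = k n"
    "\<And>n. length (outs (D n)) = 1"
    "\<And>n z. length z = N n \<Longrightarrow> ndet_accepts (D n) (N n) z \<longleftrightarrow>
       (\<exists>s. length s = d n \<and> accepts_with M (enc_circ (C n s)) (Ext n z s))"
    by metis
  have "poly_bounded (\<lambda>n. k n + P n + 1) (\<lambda>n. n)" by (intro poly_bounded_intros poly_k poly_P)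
  then have "poly_bounded (\<lambda>n. circ_size (D n)) (\<lambda>n. n)" by (rule poly_bounded_mono) (rule D(1))
  moreover have "\<forall>n. N n \<le> ninp (D n) \<and> length (outs (D n)) = 1" by (simp add: D(2,3) k_def)
  \<comment> \<open>Security holds for all large \<open>n\<close>; a single one is enough.\<close>
  ultimately obtain n where n: "\<not> (frac_accepted (D n) (N n) \<ge> 1/3 \<and>
      (\<forall>x. length x = n \<longrightarrow> \<not> ndet_accepts (D n) (N n) (G n x)))"
    using secure by blast
  \<comment> \<open>Acceptance would make \<open>Ext n (G n x) s\<close>, a value of
    \<open>C n s\<close>, a solution found by \<open>M\<close>, although such solutions avoid the
    range of \<open>C n s\<close>.\<close>
  have rejects: "\<not> ndet_accepts (D n) (N n) (G n x)" if x: "length x = n" for x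
  proof
    assume "ndet_accepts (D n) (N n) (G n x)"
    then obtain s where s: "length s = d n" "accepts_with M (enc_circ (C n s)) (Ext n (G n x) s)"
      using D(4)[OF G[OF x]] by blast
    from avoid_relD(2)[OF M_C(2)[OF s(2)]] show False
      unfolding C_simps using C_eval[OF x s(1)] x by (metis (mono_tags, lifting) imageI mem_Collect_eq)
  qed
  obtain y where y: "\<And>s. accepts_with M (enc_circ (C n s)) (y s)" using M_C(1) by metis
  have len_y: "length (y s) = m n" for s
    using avoid_relD(1)[OF M_C(2)[OF y]] by (simp add: C_simps)
  let ?acc = "{z. length z = N n \<and> ndet_accepts (D n) (N n) z}"
  let ?miss = "{z. length z = N n \<and> (\<forall>s. length s = d n \<longrightarrow> Ext n z s \<noteq> y s)}"
  \<comment> \<open>If \<open>Ext n z s\<close> equals \<open>y s\<close> for some seed, the path of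
    \<open>M\<close> that outputs \<open>y s\<close> makes \<open>D n\<close> accept
    \<open>z\<close>; so a rejected \<open>z\<close> misses for all seeds.\<close>
  have "{z :: bool list. length z = N n} \<subseteq> ?acc \<union> ?miss"
    using D(4) y by auto metis
  then have "card {z :: bool list. length z = N n} \<le> card (?acc \<union> ?miss)"
    by (intro card_mono) (auto intro: finite_subset[OF _ finite_bits[of "N n"]])
  also have "\<dots> \<le> card ?acc + card ?miss" by (rule card_Un_le)
  finally have "real (2 ^ N n) \<le> real (card ?acc + card ?miss)" unfolding card_bits of_nat_le_iff .
  moreover have "real (card ?miss) < 2 ^ N n / 2"
    by (rule extractor_missed_card[OF ext len_y])
  ultimately have "real (card ?acc) \<ge> 2 ^ N n / 2" by simp
  \<comment> \<open>Half of all strings is more than the required third.\<close>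
  then have "frac_accepted (D n) (N n) \<ge> 1/2"
    unfolding frac_accepted_def by (simp add: field_simps)
  then show False using n rejects by auto
qed

end
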